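(* For a marked graph diagram $D$, define $$Q_D=\Big(\frac{1+i}{\sqrt2}\Big)^{t_+(D)}\,[D]\Big(\frac1{\sqrt2},\frac1{\sqrt2},\frac{i}{\sqrt2},-\frac{i}{\sqrt2}\Big)\in\mathbb C .$$ Then $Q_D$ is invariant under all Yoshikawa moves except $\Omega_4$ and $\Omega_4'$; that is, if $D'$ is obtained from $D$ by any one of the moves $\Omega_1,\Omega_2,\Omega_3,\Omega_5,\Omega_6,\Omega_6',\Omega_7,\Omega_8$ (in either direction), then $Q_{D'}=Q_D$.
   Context: **Marked graph diagrams.** A marked graph diagram $D$ is a link diagram in $\mathbb R^2$ possibly with some $4$-valent marked vertices: a generic planar diagram whose double points are finitely many classical crossings (with over/under information) and finitely many marked vertices. Near a marked vertex the diagram looks like the letter X, and the vertex carries a marker, a short segment through the vertex lying in one pair of opposite sectors of the X. Diagrams are considered up to isotopy of the plane and are unoriented. In pictures, the four arms at a crossing or vertex are called NW, NE, SW, SE; a horizontal marker lies in the left and right sectors, a vertical marker in the upper and lower sectors. **State-sum.** $\widehat D$ is obtained from $D$ by removing all classical crossings (so both strands are cut at each crossing), while marked vertices are not removed (so the four arms at a marked vertex belong to the same component of $\widehat D$). A state is a map $\sigma$ from the set of connected components of $\widehat D$ to $\{0,1\}$. It is legal if at each classical crossing each label occurs an even number of times among the four arm-ends. For a legal state $\sigma$ and a classical crossing $c$, rotate the picture so that the over-strand joins SW and NE. With $a\ne b$ the two labels, $\nu(c,\sigma)$ is: $x$ if all four labels are equal; $y$ if NW$=$SE$=a$ and NE$=$SW$=b$;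 $z$ if NW$=$NE$=a$ and SW$=$SE$=b$; $w$ if NW$=$SW$=a$ and NE$=$SE$=b$. Then $$[D]=[D](x,y,z,w)=\sum_{\text{legal states }\sigma}\ \prod_{\text{classical crossings }c}\nu(c,\sigma)\in\mathbb Z[x,y,z,w].$$ **Positive resolution and $t_+$.** The positive resolution diagram $D_+$ is the link diagram obtained from $D$ by smoothing each marked vertex along its marker: for a horizontal marker, the X is replaced by one arc joining the NW and NE arms and one arc joining the SW and SE arms, parallel to the marker. $t_+(D)=sw(D_+)$ is the self-writhe of $D_+$: the sum, over the components of the link, of the writhe of the sub-diagram of that component (only crossings of a component with itself count; a crossing is positive if, rotated so that both strands point upward, the over-strand runs from SW to NE). **Yoshikawa moves.** The Yoshikawa moves are $\Omega_1,\Omega_2,\Omega_3,\Omega_4,\Omega_4',\Omega_5,\Omega_6,\Omega_6',\Omega_7,\Omega_8$. Each move replaces the part of the diagram in a disk by another one with the same boundary points, the rest being unchanged (moves may be used in both directions, up to isotopy of the plane). - $\Omega_1$: a crossing with over-strand SW–NE, whose NE and SE arms are joined by an arc on the right and whose NW and SW arms go to the boundary, $\leftrightarrow$ a simple arc. - $\Omega_2$: two arcs, the left one passing over the right one at two crossings that bound a bigon, $\leftrightarrow$ two disjoint arcs. - $\Omega_3$: two straight strands crossing at a point, the NW–SE strand over the SW–NE strand, and a third, left-to-right, strand $H$ passing over both; $H$ passes below the crossing point (crossing its SW and SE arms) $\leftrightarrow$ $H$ passes above it (crossing the NW and NE arms). - $\Omega_4$: a marked vertex with horizontal marker and a left-to-right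 strand $H$; $H$ passes over the SW and SE arms $\leftrightarrow$ $H$ passes over the NW and NE arms. - $\Omega_4'$: as $\Omega_4$, but $H$ passes under the arms. - $\Omega_5$: a crossing with over-strand SW–NE on the left and a marked vertex with horizontal marker on the right, with the NE (resp. SE) arm of the crossing joined to the NW (resp. SW) arm of the vertex, the other four arms going to the boundary, $\leftrightarrow$ the marked vertex with horizontal marker on the left and a crossing with over-strand SW–NE on the right, joined in the same way. - $\Omega_6$: a marked vertex with vertical marker whose NE and SE arms are joined by an arc on the right and whose NW and SW arms go to the boundary $\leftrightarrow$ a simple arc. - $\Omega_6'$: as $\Omega_6$, with horizontal marker. - $\Omega_7$: a disk with boundary points $t_1,t_2,t_3$ on top and $b_1,b_2,b_3$ at the bottom (left to right), no crossings. One side: a lower-left vertex $v$ with vertical marker and an upper-right vertex $v'$ with horizontal marker; $v$ has SW to $b_1$, NW to $t_1$, SE to $b_2$, NE joined to the SW arm of $v'$; $v'$ has NW to $t_2$, NE to $t_3$, SE to $b_3$. Other side: an upper-left vertex $u$ with vertical marker and a lower-right vertex $u'$ with horizontal marker; $u$ has NW to $t_1$, NE to $t_2$, SW to $b_1$, SE joined to the NW arm of $u'$; $u'$ has SW to $b_2$, SE to $b_3$, NE to $t_3$. - $\Omega_8$: a disk with boundary points $t_1,\dots,t_4$ on top and $b_1,\dots,b_4$ at the bottom. A left vertex $v$ with vertical marker has NW to $t_1$, NE to $t_2$, SW to $b_3$, SE to $b_4$; a right vertex $v'$ with horizontal marker has NW to $t_3$, NE to $t_4$, SW to $b_1$, SE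 to $b_2$; the two parallel lower arms of $v$ cross the two parallel lower arms of $v'$ in exactly four crossings. On one side the arms of $v'$ are over at all four crossings $\leftrightarrow$ on the other side the arms of $v$ are over at all four crossings. *)

theory Defs
  imports Complex_Main "HOL-Library.FuncSet"
begin

section \<open>Marked graph diagrams\<close>

text \<open>
  A planar diagram is put in general position with respect to the height function and cut
  by horizontal lines into slices, listed from bottom to top. The slice \<open>(l, e, r)\<close>
  consists of \<open>l\<close> vertical strands, one elementary piece \<open>e\<close>, and \<open>r\<close> vertical strands, from
  left to right. \<open>Cup\<close> is a local minimum and \<open>Cap\<close> a local maximum; a crossing is given by
  its over-strand, a marked vertex by the direction of its marker.
\<close>

datatype over_strand = SW_NE | NW_SE
datatype marker = Horizontal | Vertical
datatype piece = Cup | Cap | Crossing over_strand | Vertex marker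

type_synonym slice = "nat \<times> piece \<times> nat"

fun lower_ends :: "piece \<Rightarrow> nat" where
  "lower_ends Cup = 0"
| "lower_ends Cap = 2"
| "lower_ends (Crossing _) = 2"
| "lower_ends (Vertex _) = 2"

fun upper_ends :: "piece \<Rightarrow> nat" where
  "upper_ends Cup = 2"
| "upper_ends Cap = 0"
| "upper_ends (Crossing _) = 2"
| "upper_ends (Vertex _) = 2"

text \<open>\<open>tangle a T b\<close>: consecutive slices match, with \<open>a\<close> strand ends at the bottom and
  \<open>b\<close> at the top. The empty list consists of vertical strands only.\<close>

fun tangle :: "nat \<Rightarrow> slice list \<Rightarrow> nat \<Rightarrow> bool" where
  "tangle a [] b \<longleftrightarrow> a = b"
| "tangle a ((l, e, r) # T) b \<longleftrightarrow>
     a = l + lower_ends e + r \<and> tangle (l + upper_ends e + r) T b"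

definition diagram :: "slice list \<Rightarrow> bool" where
  "diagram D \<longleftrightarrow> tangle 0 D 0"

text \<open>
  The point \<open>(j, p)\<close> is the \<open>p\<close>-th intersection (from the left, counting from 0) of the
  diagram with the horizontal line below slice number \<open>j\<close> (equivalently, above slice number
  \<open>j - 1\<close>). Every arc of the diagram meets one of these lines.
\<close>

type_synonym point = "nat \<times> nat"

fun slice_points :: "nat \<Rightarrow> slice \<Rightarrow> point set" where
  "slice_points j (l, e, r) =
     {(j, p) | p. p < l + lower_ends e + r} \<union> {(Suc j, p) | p. p < l + upper_ends e + r}"

definition points :: "slice list \<Rightarrow> point set" where
  "points D = (\<Union>j<length D. slice_points j (D ! j))"

fun vertical_strands :: "nat \<Rightarrow> slice \<Rightarrow> (point \<times> point) set" where
  "vertical_strands j (l, e, r) =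
     {((j, p), (Suc j, p)) | p. p < l} \<union>
     {((j, l + lower_ends e + p), (Suc j, l + upper_ends e + p)) | p. p < r}"

datatype arm = NW | NE | SW | SE

definition arm_end :: "slice list \<Rightarrow> nat \<Rightarrow> arm \<Rightarrow> point" where
  "arm_end D j a = (let l = fst (D ! j) in
     case a of SW \<Rightarrow> (j, l) | SE \<Rightarrow> (j, Suc l) | NW \<Rightarrow> (Suc j, l) | NE \<Rightarrow> (Suc j, Suc l))"

definition crossings :: "slice list \<Rightarrow> nat set" where
  "crossings D = {j. j < length D \<and> (\<exists>l s r. D ! j = (l, Crossing s, r))}"

definition over :: "slice list \<Rightarrow> nat \<Rightarrow> over_strand" where
  "over D j = (THE s. \<exists>l r. D ! j = (l, Crossing s, r))"


section \<open>The state sum\<close>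

definition equiv_generated :: "(point \<times> point) set \<Rightarrow> (point \<times> point) set" where
  "equiv_generated R = (R \<union> R\<inverse>)\<^sup>*"

text \<open>Connections in the diagram with all classical crossings removed: a crossing contributes
  none, a marked vertex connects all its four arms.\<close>

fun hat_links :: "nat \<Rightarrow> slice \<Rightarrow> (point \<times> point) set" where
  "hat_links j (l, e, r) = vertical_strands j (l, e, r) \<union>
     (case e of
        Cup \<Rightarrow> {((Suc j, l), (Suc j, Suc l))}
      | Cap \<Rightarrow> {((j, l), (j, Suc l))}
      | Crossing _ \<Rightarrow> {}
      | Vertex _ \<Rightarrow> {((j, l), (j, Suc l)), ((j, l), (Suc j, l)), ((j, l), (Suc j, Suc l))})"

definition hat_connected :: "slice list \<Rightarrow> (point \<times> point) set" where
  "hat_connected D = equiv_generated (\<Union>j<length D. hat_links j (D ! j))"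

definition hat_components :: "slice list \<Rightarrow> point set set" where
  "hat_components D = points D // hat_connected D"

definition states :: "slice list \<Rightarrow> (point set \<Rightarrow> nat) set" where
  "states D = (hat_components D \<rightarrow>\<^sub>E {0, 1})"

definition arm_label :: "slice list \<Rightarrow> (point set \<Rightarrow> nat) \<Rightarrow> nat \<Rightarrow> arm \<Rightarrow> nat" where
  "arm_label D \<sigma> j a = \<sigma> (hat_connected D `` {arm_end D j a})"

definition legal :: "slice list \<Rightarrow> (point set \<Rightarrow> nat) \<Rightarrow> bool" where
  "legal D \<sigma> \<longleftrightarrow>
     (\<forall>j\<in>crossings D. \<forall>b\<in>{0, 1}. even (card {a. arm_label D \<sigma> j a = b}))"

text \<open>The labels after a counterclockwise quarter turn of the picture.\<close>

definition turn_labels :: "(arm \<Rightarrow> nat) \<Rightarrow> arm \<Rightarrow> nat" where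
  "turn_labels f a = (case a of SW \<Rightarrow> f NW | SE \<Rightarrow> f SW | NE \<Rightarrow> f SE | NW \<Rightarrow> f NE)"

text \<open>The value 0 in the last case is never used: it does not occur for legal states.\<close>

definition pattern_weight ::
  "'a::comm_ring_1 \<Rightarrow> 'a \<Rightarrow> 'a \<Rightarrow> 'a \<Rightarrow> (arm \<Rightarrow> nat) \<Rightarrow> 'a" where
  "pattern_weight x y z w f =
     (if f NW = f NE \<and> f NE = f SE \<and> f SE = f SW then x
      else if f NW = f SE \<and> f NE = f SW then y
      else if f NW = f NE \<and> f SW = f SE then z
      else if f NW = f SW \<and> f NE = f SE then w
      else 0)"

definition crossing_weight ::
  "'a::comm_ring_1 \<Rightarrow> 'a \<Rightarrow> 'a \<Rightarrow> 'a \<Rightarrow> slice list \<Rightarrow> (point set \<Rightarrow> nat) \<Rightarrow> nat \<Rightarrow> 'a" where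
  "crossing_weight x y z w D \<sigma> j =
     pattern_weight x y z w
       (case over D j of
          SW_NE \<Rightarrow> arm_label D \<sigma> j
        | NW_SE \<Rightarrow> turn_labels (arm_label D \<sigma> j))"

text \<open>The value at \<open>(x, y, z, w)\<close> of the integer polynomial \<open>[D]\<close>.\<close>

definition state_sum ::
  "slice list \<Rightarrow> 'a::comm_ring_1 \<Rightarrow> 'a \<Rightarrow> 'a \<Rightarrow> 'a \<Rightarrow> 'a" where
  "state_sum D x y z w =
     (\<Sum>\<sigma> | \<sigma> \<in> states D \<and> legal D \<sigma>. \<Prod>j\<in>crossings D. crossing_weight x y z w D \<sigma> j)"


section \<open>Positive resolution and self-writhe\<close>

text \<open>A horizontal marker gives an arc joining the two lower arms below an arc joining the two
  upper arms; a vertical marker gives two vertical strands, so that the slice disappears.\<close>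

fun smooth :: "slice \<Rightarrow> slice list" where
  "smooth (l, Vertex Horizontal, r) = [(l, Cap, r), (l, Cup, r)]"
| "smooth (l, Vertex Vertical, r) = []"
| "smooth s = [s]"

definition positive_resolution :: "slice list \<Rightarrow> slice list" where
  "positive_resolution D = concat (map smooth D)"

text \<open>In the following, \<open>L\<close> is a link diagram, that is, a diagram without marked vertices.\<close>

fun link_links :: "nat \<Rightarrow> slice \<Rightarrow> (point \<times> point) set" where
  "link_links j (l, e, r) = vertical_strands j (l, e, r) \<union>
     (case e of
        Cup \<Rightarrow> {((Suc j, l), (Suc j, Suc l))}
      | Cap \<Rightarrow> {((j, l), (j, Suc l))}
      | Crossing _ \<Rightarrow> {((j, l), (Suc j, Suc l)), ((j, Suc l), (Suc j, l))}
      | Vertex _ \<Rightarrow> {})"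

definition link_components :: "slice list \<Rightarrow> point set set" where
  "link_components L = points L // equiv_generated (\<Union>j<length L. link_links j (L ! j))"

text \<open>An orientation of the link: \<open>up p\<close> means that the strand through \<open>p\<close> is directed upward
  there.\<close>

fun slice_orientation :: "(point \<Rightarrow> bool) \<Rightarrow> nat \<Rightarrow> slice \<Rightarrow> bool" where
  "slice_orientation up j (l, e, r) \<longleftrightarrow>
     (\<forall>(p, q)\<in>vertical_strands j (l, e, r). up p = up q) \<and>
     (case e of
        Cup \<Rightarrow> up (Suc j, l) \<noteq> up (Suc j, Suc l)
      | Cap \<Rightarrow> up (j, l) \<noteq> up (j, Suc l)
      | Crossing _ \<Rightarrow> up (j, l) = up (Suc j, Suc l) \<and> up (j, Suc l) = up (Suc j, l)
      | Vertex _ \<Rightarrow> True)"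

definition link_orientation :: "slice list \<Rightarrow> (point \<Rightarrow> bool) \<Rightarrow> bool" where
  "link_orientation L up \<longleftrightarrow> (\<forall>j<length L. slice_orientation up j (L ! j))"

text \<open>If both strands point upward, or both downward, then no turn or a half turn makes both
  point upward, and the over-strand keeps its position. Otherwise both point to the right or
  both to the left, and a quarter turn is needed, which moves an over-strand joining NW and SE
  to the position SW, NE and vice versa.\<close>

definition crossing_sign :: "slice list \<Rightarrow> (point \<Rightarrow> bool) \<Rightarrow> nat \<Rightarrow> int" where
  "crossing_sign L up j =
     (if over L j = (if up (arm_end L j SW) = up (arm_end L j SE) then SW_NE else NW_SE)
      then 1 else - 1)"

text \<open>Reversing a component does not change the signs of its self-crossings, so the choice of
  orientation is immaterial.\<close>

definition self_writhe :: "slice list \<Rightarrow> int" where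
  "self_writhe L = (let up = (SOME up. link_orientation L up) in
     \<Sum>K\<in>link_components L.
       \<Sum>j | j \<in> crossings L \<and> arm_end L j SW \<in> K \<and> arm_end L j SE \<in> K. crossing_sign L up j)"

definition t_plus :: "slice list \<Rightarrow> int" where
  "t_plus D = self_writhe (positive_resolution D)"

definition Q_inv :: "slice list \<Rightarrow> complex" where
  "Q_inv D =
     ((1 + \<i>) / complex_of_real (sqrt 2)) powi t_plus D *
     state_sum D (1 / complex_of_real (sqrt 2)) (1 / complex_of_real (sqrt 2))
       (\<i> / complex_of_real (sqrt 2)) (- (\<i> / complex_of_real (sqrt 2)))"


section \<open>Planar isotopy and Yoshikawa moves\<close>

text \<open>Replacing a part \<open>T\<close> of a diagram in a disk by \<open>T'\<close>. The rectangle containing \<open>T\<close> has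
  \<open>n\<close> boundary points at the bottom, and \<open>l\<close> and \<open>r\<close> strands pass to its left and right.\<close>

definition embed :: "nat \<Rightarrow> nat \<Rightarrow> slice list \<Rightarrow> slice list" where
  "embed l r T = map (\<lambda>(l', e, r'). (l + l', e, r' + r)) T"

inductive replace ::
  "(nat \<Rightarrow> slice list \<Rightarrow> slice list \<Rightarrow> bool) \<Rightarrow> slice list \<Rightarrow> slice list \<Rightarrow> bool"
  for rule :: "nat \<Rightarrow> slice list \<Rightarrow> slice list \<Rightarrow> bool"
where
  "\<lbrakk>rule n T T'; tangle 0 A (l + n + r);
    diagram (A @ embed l r T @ B); diagram (A @ embed l r T' @ B)\<rbrakk>
   \<Longrightarrow> replace rule (A @ embed l r T @ B) (A @ embed l r T' @ B)"

text \<open>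
  Isotopy of the plane, in terms of slices, is generated by exchanging the heights of two pieces
  lying beside each other, by straightening zigzags, and by rotating a crossing or marked vertex
  by a quarter turn. (This is the usual presentation of unoriented planar diagrams up to
  isotopy, i.e. of the free strict pivotal category on a self-dual object.) In the rotation rule
  the piece on the left-hand side has its NE, SE, SW, NW arms bent around so as to become the
  NW, NE, SE, SW arms, respectively.
\<close>

fun turn_over :: "over_strand \<Rightarrow> over_strand" where
  "turn_over SW_NE = NW_SE"
| "turn_over NW_SE = SW_NE"

fun turn_marker :: "marker \<Rightarrow> marker" where
  "turn_marker Horizontal = Vertical"
| "turn_marker Vertical = Horizontal"

inductive isotopy_rule :: "nat \<Rightarrow> slice list \<Rightarrow> slice list \<Rightarrow> bool" where
  exchange: "isotopy_rule (lower_ends e + d + lower_ends f)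
     [(0, e, d + lower_ends f), (upper_ends e + d, f, 0)]
     [(lower_ends e + d, f, 0), (0, e, d + upper_ends f)]"
| zigzag_left: "isotopy_rule 1 [(1, Cup, 0), (0, Cap, 1)] []"
| zigzag_right: "isotopy_rule 1 [(0, Cup, 1), (1, Cap, 0)] []"
| rotate_crossing: "isotopy_rule 2
     [(2, Cup, 0), (1, Crossing s, 1), (0, Cap, 2)] [(0, Crossing (turn_over s), 0)]"
| rotate_vertex: "isotopy_rule 2
     [(2, Cup, 0), (1, Vertex m, 1), (0, Cap, 2)] [(0, Vertex (turn_marker m), 0)]"

definition isotopic :: "slice list \<Rightarrow> slice list \<Rightarrow> bool" where
  "isotopic = equivclp (replace isotopy_rule)"

datatype yoshikawa_move =
  Omega1 | Omega2 | Omega3 | Omega4 | Omega4' | Omega5 | Omega6 | Omega6' | Omega7 | Omega8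

text \<open>
  The number of boundary points at the bottom and the two sides of each move. The left-to-right
  strand \<open>H\<close> of \<open>Omega3\<close>, \<open>Omega4\<close>, \<open>Omega4'\<close> enters at the leftmost bottom point and leaves
  at the rightmost top point. In \<open>Omega5\<close> the left crossing or vertex has its SW and NW arms
  at the first bottom and top point, the right one its SE and NE arms at the second bottom and
  top point; the \<open>Cup\<close> and \<open>Cap\<close> join the SE and SW, respectively NE and NW, arms facing each
  other. In \<open>Omega8\<close> the arms of the left vertex run from lower right to upper left.
\<close>

fun move_sides :: "yoshikawa_move \<Rightarrow> nat \<times> slice list \<times> slice list" where
  "move_sides Omega1 =
     (1, [(1, Cup, 0), (0, Crossing SW_NE, 1), (1, Cap, 0)],
         [])"
| "move_sides Omega2 =
     (2, [(0, Crossing SW_NE, 0), (0, Crossing NW_SE, 0)],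
         [])"
| "move_sides Omega3 =
     (3, [(0, Crossing SW_NE, 1), (1, Crossing SW_NE, 0), (0, Crossing NW_SE, 1)],
         [(1, Crossing NW_SE, 0), (0, Crossing SW_NE, 1), (1, Crossing SW_NE, 0)])"
| "move_sides Omega4 =
     (3, [(0, Crossing SW_NE, 1), (1, Crossing SW_NE, 0), (0, Vertex Horizontal, 1)],
         [(1, Vertex Horizontal, 0), (0, Crossing SW_NE, 1), (1, Crossing SW_NE, 0)])"
| "move_sides Omega4' =
     (3, [(0, Crossing NW_SE, 1), (1, Crossing NW_SE, 0), (0, Vertex Horizontal, 1)],
         [(1, Vertex Horizontal, 0), (0, Crossing NW_SE, 1), (1, Crossing NW_SE, 0)])"
| "move_sides Omega5 =
     (2, [(1, Cup, 1), (0, Crossing SW_NE, 2), (2, Vertex Horizontal, 0), (1, Cap, 1)],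
         [(1, Cup, 1), (0, Vertex Horizontal, 2), (2, Crossing SW_NE, 0), (1, Cap, 1)])"
| "move_sides Omega6 =
     (1, [(1, Cup, 0), (0, Vertex Vertical, 1), (1, Cap, 0)],
         [])"
| "move_sides Omega6' =
     (1, [(1, Cup, 0), (0, Vertex Horizontal, 1), (1, Cap, 0)],
         [])"
| "move_sides Omega7 =
     (3, [(0, Vertex Vertical, 1), (1, Vertex Horizontal, 0)],
         [(1, Vertex Horizontal, 0), (0, Vertex Vertical, 1)])"
| "move_sides Omega8 =
     (4, [(1, Crossing SW_NE, 1), (0, Crossing SW_NE, 2), (2, Crossing SW_NE, 0),
          (1, Crossing SW_NE, 1), (0, Vertex Vertical, 2), (2, Vertex Horizontal, 0)],
         [(1, Crossing NW_SE, 1), (0, Crossing NW_SE, 2), (2, Crossing NW_SE, 0),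
          (1, Crossing NW_SE, 1), (0, Vertex Vertical, 2), (2, Vertex Horizontal, 0)])"

text \<open>\<open>D'\<close> is obtained from \<open>D\<close> by the move \<open>m\<close>, in either direction, up to isotopy.\<close>

definition move_rule :: "yoshikawa_move \<Rightarrow> nat \<Rightarrow> slice list \<Rightarrow> slice list \<Rightarrow> bool" where
  "move_rule m n T T' \<longleftrightarrow> move_sides m = (n, T, T') \<or> move_sides m = (n, T', T)"

definition obtained_by :: "yoshikawa_move \<Rightarrow> slice list \<Rightarrow> slice list \<Rightarrow> bool" where
  "obtained_by m D D' \<longleftrightarrow>
     (\<exists>E E'. isotopic D E \<and> replace (move_rule m) E E' \<and> isotopic E' D')"

end

theory Submission
  imports Defs
begin

text \<open>
  Both factors of \<open>Q\<close> are handled as partition functions of vertex models on the diagram: label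
  the strand ends on every level by booleans, multiply local weights of the slices, and sum over
  all labellings. Read from bottom to top, such a sum is a composition of transfer operators, one
  for each slice. Hence, if the two sides of a move have proportional transfer operators, the
  partition functions of the two diagrams are proportional with the same factor, whatever
  surrounds the move (\<open>partition_function_replace\<close>). For a given move this is a finite
  computation with at most four strand ends on any level.

  For the state sum the vertex model is immediate: a state is a labelling of the points that is
  constant along the strands of the diagram with its crossings removed, and the weight of an
  illegal pattern is zero (\<open>state_sum_eq_partition_function\<close>).

  The self-writhe is not visibly local, since one has to know which crossings are
  self-crossings. It becomes local by taking all orientations of the link into account. At a
  self-crossing the sign is the same for all orientations. At a crossing of two different
  components, reversing one of them is an involution on the orientations that changes the sign,
  so the signs cancel in the sum. Hence the sum of the total writhe over all orientations is the
  number of orientations times the self-writhe (\<open>sum_total_writhe\<close>). So, if \<open>Z(h)\<close> denotes the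
  sum of \<open>exp (h * writhe)\<close> over all orientations, the self-writhe is \<open>Z'(0) / Z(0)\<close>, and \<open>Z\<close> is a
  partition function: the label of a point says whether the strand points upward there. A marked
  vertex gets the weight of its smoothing, so that the model lives on the marked diagram itself.
  If a move multiplies \<open>Z(h)\<close> by \<open>c * exp (h * k)\<close>, then \<open>t_plus\<close> grows by \<open>k\<close>
  (\<open>t_plus_shift\<close>). This needs \<open>Z(0) \<noteq> 0\<close>, that is, the existence of an orientation
  (\<open>transfer_writhe_positive\<close>).

  Exchanging heights is respected by every vertex model (\<open>proportional_exchange\<close>). The other
  isotopies and the moves \<open>Omega2\<close>, \<open>Omega3\<close>, \<open>Omega5\<close>, \<open>Omega6\<close>, \<open>Omega6'\<close>, \<open>Omega7\<close>, \<open>Omega8\<close>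
  leave the state sum unchanged and have \<open>k = 0\<close>; there \<open>c = 2\<close> for \<open>Omega6\<close>, whose positive
  resolution splits off a circle, and \<open>c = 1\<close> otherwise. For \<open>Omega1\<close> the kink has \<open>k = 1\<close> and
  multiplies the state sum by \<open>x + w = (1 - \<i>) / sqrt 2\<close>, the inverse of \<open>(1 + \<i>) / sqrt 2\<close>, so
  the two changes cancel.
\<close>

section \<open>Transfer operators of vertex models\<close>

definition labels :: "nat \<Rightarrow> bool list set" where
  "labels n = {u. length u = n}"

text \<open>The weight \<open>W e u v\<close> of a piece depends on the labels \<open>u\<close> of its lower and \<open>v\<close> of its upper
  ends. The operator turns a function of the labels at the top of a tangle into a function of the
  labels at its bottom; in this direction a concrete tangle is evaluated by rewriting, slice by
  slice from the bottom.\<close>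

fun transfer :: "(piece \<Rightarrow> bool list \<Rightarrow> bool list \<Rightarrow> 'a::comm_ring_1) \<Rightarrow> slice list \<Rightarrow>
    (bool list \<Rightarrow> 'a) \<Rightarrow> bool list \<Rightarrow> 'a" where
  "transfer W [] f u = f u"
| "transfer W ((l, e, r) # T) f u =
     (\<Sum>v\<in>labels (upper_ends e). W e (take (lower_ends e) (drop l u)) v *
        transfer W T f (take l u @ v @ drop (l + lower_ends e) u))"

declare transfer.simps(2) [simp del]

text \<open>A diagram has no ends, so its operator is a scalar.\<close>

definition partition_function ::
  "(piece \<Rightarrow> bool list \<Rightarrow> bool list \<Rightarrow> 'a::comm_ring_1) \<Rightarrow> slice list \<Rightarrow> 'a" where
  "partition_function W D = transfer W D (\<lambda>_. 1) []"

definition proportional ::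
  "(piece \<Rightarrow> bool list \<Rightarrow> bool list \<Rightarrow> 'a::comm_ring_1) \<Rightarrow> nat \<Rightarrow> 'a \<Rightarrow>
    slice list \<Rightarrow> slice list \<Rightarrow> bool" where
  "proportional W n c T T' \<longleftrightarrow>
     (\<forall>f u. length u = n \<longrightarrow> transfer W T' f u = c * transfer W T f u)"

lemma length_eq_small:
  "length u = 1 \<longleftrightarrow> (\<exists>a. u = [a])"
  "length u = 2 \<longleftrightarrow> (\<exists>a b. u = [a, b])"
  "length u = 3 \<longleftrightarrow> (\<exists>a b c. u = [a, b, c])"
  "length u = 4 \<longleftrightarrow> (\<exists>a b c d. u = [a, b, c, d])"
  by (auto simp: numeral_eq_Suc length_Suc_conv)

lemma labels_0: "labels 0 = {[]}"
  by (auto simp: labels_def)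

lemma labels_2: "labels 2 = {[False, False], [False, True], [True, False], [True, True]}"
  by (auto simp: labels_def length_eq_small)

lemma sum_labels: "(\<Sum>v\<in>labels 0. F v) = F []"
  "(\<Sum>v\<in>labels 2. F v) = F [False, False] + (F [False, True] + (F [True, False] + F [True, True]))"
  by (simp_all add: labels_0 labels_2)

lemma finite_labels [simp]: "finite (labels n)"
  unfolding labels_def using finite_lists_length_eq[of "UNIV :: bool set" n] by simp

lemma transfer_append: "transfer W (A @ B) f = transfer W A (transfer W B f)"
proof
  fix u show "transfer W (A @ B) f u = transfer W A (transfer W B f) u"
    by (induction W A f u rule: transfer.induct) (simp_all add: transfer.simps(2))
qed

text \<open>The strands on both sides of a disk carry their labels through unchanged, so they only enter
  as parameters of the function to which the operator of the disk is applied.\<close>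

lemma transfer_embed:
  assumes "tangle n T b" "length p = l" "length u = n"
  shows "transfer W (embed l r T) f (p @ u @ q) = transfer W T (\<lambda>v. f (p @ v @ q)) u"
  using assms(1,3)
proof (induction T arbitrary: n u)
  case (Cons s T)
  obtain l' e r' where s: "s = (l', e, r')" by (cases s)
  have n: "length u = l' + lower_ends e + r'" and T: "tangle (l' + upper_ends e + r') T b"
    using Cons.prems s by auto
  have "transfer W (embed l r T) f (p @ (take l' u @ v @ drop (l' + lower_ends e) u) @ q) =
     transfer W T (\<lambda>v. f (p @ v @ q)) (take l' u @ v @ drop (l' + lower_ends e) u)"
    if "v \<in> labels (upper_ends e)" for v
    using that n by (intro Cons.IH[OF T]) (auto simp: labels_def)
  then show ?case
    using n assms(2) by (simp add: s embed_def transfer.simps(2))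
qed (simp add: embed_def)

lemma transfer_scaled_cong:
  assumes "tangle a T b" "length u = a" "\<And>v. length v = b \<Longrightarrow> f' v = c * f v"
  shows "transfer W T f' u = c * transfer W T f u"
  using assms(1,2)
proof (induction T arbitrary: a u)
  case (Cons s T)
  obtain l e r where s: "s = (l, e, r)" by (cases s)
  have n: "length u = l + lower_ends e + r" and T: "tangle (l + upper_ends e + r) T b"
    using Cons.prems s by auto
  have "transfer W T f' (take l u @ v @ drop (l + lower_ends e) u) =
     c * transfer W T f (take l u @ v @ drop (l + lower_ends e) u)"
    if "v \<in> labels (upper_ends e)" for v
    using that n by (intro Cons.IH[OF T]) (auto simp: labels_def)
  then show ?case
    by (simp add: s transfer.simps(2) sum_distrib_left mult.left_commute)
qed (use assms(3) in simp)

lemma tangle_append: "tangle a (S @ T) b \<longleftrightarrow> (\<exists>c. tangle a S c \<and> tangle c T b)"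
  by (induction S arbitrary: a) auto

lemma tangle_top_unique: "tangle a T b \<Longrightarrow> tangle a T c \<Longrightarrow> b = c"
  by (induction T arbitrary: a) auto

lemma tangle_embedD:
  assumes "tangle (l + n + r) (embed l r T) c"
  shows "\<exists>b. tangle n T b"
  using assms
proof (induction T arbitrary: n)
  case (Cons s T)
  obtain l' e r' where s: "s = (l', e, r')" by (cases s)
  have n: "n = l' + lower_ends e + r'" and T: "tangle (l + (l' + upper_ends e + r') + r) (embed l r T) c"
    using Cons.prems s by (auto simp: embed_def add_ac)
  then show ?case using Cons.IH[OF T] s by auto
qed auto

text \<open>The locality principle: the operator of the surrounding diagram is a composition, and every
  factor is linear, so a scalar relating the operators of the two disks comes out.\<close>

lemma partition_function_replace:
  assumes scaled: "proportional W n c T T'"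
    and A: "tangle 0 A (l + n + r)"
    and d: "diagram (A @ embed l r T @ B)" "diagram (A @ embed l r T' @ B)"
  shows "partition_function W (A @ embed l r T' @ B) = c * partition_function W (A @ embed l r T @ B)"
proof -
  obtain b where b: "tangle n T b"
    using d(1) A tangle_embedD tangle_top_unique unfolding diagram_def tangle_append by metis
  obtain b' where b': "tangle n T' b'"
    using d(2) A tangle_embedD tangle_top_unique unfolding diagram_def tangle_append by metis
  let ?F = "transfer W B (\<lambda>_. 1)"
  have "transfer W (embed l r T') ?F u = c * transfer W (embed l r T) ?F u"
    if u: "length u = l + n + r" for u
  proof -
    define p m q where "p = take l u" and "m = take n (drop l u)" and "q = drop (l + n) u"
    have "u = p @ m @ q"
      unfolding p_def m_def q_def by (metis append_take_drop_id drop_drop add.commute)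
    moreover have "length p = l" "length m = n"
      using u by (auto simp: p_def m_def)
    ultimately show ?thesis
      using scaled by (simp add: transfer_embed[OF b] transfer_embed[OF b'] proportional_def)
  qed
  then have "transfer W A (transfer W (embed l r T') ?F) [] =
      c * transfer W A (transfer W (embed l r T) ?F) []"
    by (intro transfer_scaled_cong[OF A]) simp_all
  then show ?thesis
    by (simp add: partition_function_def transfer_append)
qed

text \<open>Operators acting on disjoint sets of strands commute, for any weights.\<close>

lemma proportional_exchange:
  "proportional W (lower_ends e + d + lower_ends f) 1
     [(0, e, d + lower_ends f), (upper_ends e + d, f, 0)]
     [(lower_ends e + d, f, 0), (0, e, d + upper_ends f)]"
  unfolding proportional_def
proof (intro allI impI)
  fix F :: "bool list \<Rightarrow> 'a" and u :: "bool list"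
  assume u: "length u = lower_ends e + d + lower_ends f"
  define a m c where "a = take (lower_ends e) u" and "m = take d (drop (lower_ends e) u)"
    and "c = drop (lower_ends e + d) u"
  have u_eq: "u = a @ m @ c"
    unfolding a_def m_def c_def by (metis append_take_drop_id drop_drop add.commute)
  have len: "length a = lower_ends e" "length m = d" "length c = lower_ends f"
    using u by (auto simp: a_def m_def c_def)
  have "transfer W [(0, e, d + lower_ends f), (upper_ends e + d, f, 0)] F u =
    (\<Sum>v\<in>labels (upper_ends e). \<Sum>w\<in>labels (upper_ends f). W e a v * (W f c w * F (v @ m @ w)))"
    by (auto simp: transfer.simps(2) u_eq len labels_def sum_distrib_left intro!: sum.cong)
  also have "\<dots> =
    (\<Sum>w\<in>labels (upper_ends f). \<Sum>v\<in>labels (upper_ends e). W f c w * (W e a v * F (v @ m @ w)))"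
    by (subst sum.swap) (simp add: mult.left_commute)
  also have "\<dots> = transfer W [(lower_ends e + d, f, 0), (0, e, d + upper_ends f)] F u"
    by (auto simp: transfer.simps(2) u_eq len labels_def sum_distrib_left intro!: sum.cong)
  finally show "transfer W [(lower_ends e + d, f, 0), (0, e, d + upper_ends f)] F u =
    1 * transfer W [(0, e, d + lower_ends f), (upper_ends e + d, f, 0)] F u"
    by simp
qed

section \<open>Partition functions as sums over labellings of the points\<close>

fun lower_width :: "slice \<Rightarrow> nat" where
  "lower_width (l, e, r) = l + lower_ends e + r"

fun upper_width :: "slice \<Rightarrow> nat" where
  "upper_width (l, e, r) = l + upper_ends e + r"

text \<open>The operator of a slice as a matrix indexed by the labels of all its lower and upper ends,
  including those of the vertical strands.\<close>

fun slice_matrix :: "(piece \<Rightarrow> bool list \<Rightarrow> bool list \<Rightarrow> 'a::comm_ring_1) \<Rightarrow> slice \<Rightarrow>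
    bool list \<Rightarrow> bool list \<Rightarrow> 'a" where
  "slice_matrix W (l, e, r) u v =
     (if take l u = take l v \<and> drop (l + lower_ends e) u = drop (l + upper_ends e) v
      then W e (take (lower_ends e) (drop l u)) (take (upper_ends e) (drop l v)) else 0)"

text \<open>A history lists the labels on the successive levels of a tangle, above its bottom level.\<close>

fun histories :: "slice list \<Rightarrow> bool list list set" where
  "histories [] = {[]}"
| "histories (s # T) = (\<lambda>(v, us). v # us) ` (labels (upper_width s) \<times> histories T)"

fun history_weight :: "(piece \<Rightarrow> bool list \<Rightarrow> bool list \<Rightarrow> 'a::comm_ring_1) \<Rightarrow> slice list \<Rightarrow>
    bool list \<Rightarrow> bool list list \<Rightarrow> 'a" where
  "history_weight W [] u us = 1"
| "history_weight W (s # T) u us = slice_matrix W s u (hd us) * history_weight W T (hd us) (tl us)"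

lemma sum_slice_matrix:
  assumes "length u = lower_width (l, e, r)"
  shows "(\<Sum>v\<in>labels (upper_width (l, e, r)). slice_matrix W (l, e, r) u v * F v) =
    (\<Sum>v\<in>labels (upper_ends e). W e (take (lower_ends e) (drop l u)) v *
       F (take l u @ v @ drop (l + lower_ends e) u))"
proof -
  let ?h = "\<lambda>v. take l u @ v @ drop (l + lower_ends e) u"
  have inj: "inj_on ?h (labels (upper_ends e))"
    by (auto simp: inj_on_def)
  have "(\<Sum>v\<in>labels (upper_ends e). W e (take (lower_ends e) (drop l u)) v * F (?h v)) =
    (\<Sum>v\<in>labels (upper_ends e). slice_matrix W (l, e, r) u (?h v) * F (?h v))"
    using assms by (intro sum.cong) (auto simp: labels_def)
  also have "\<dots> = (\<Sum>v\<in>?h ` labels (upper_ends e). slice_matrix W (l, e, r) u v * F v)"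
    by (simp only: sum.reindex[OF inj] o_def)
  also have "\<dots> = (\<Sum>v\<in>labels (upper_width (l, e, r)). slice_matrix W (l, e, r) u v * F v)"
  proof (intro sum.mono_neutral_left ballI)
    show "?h ` labels (upper_ends e) \<subseteq> labels (upper_width (l, e, r))"
      using assms by (auto simp: labels_def)
    fix v assume v: "v \<in> labels (upper_width (l, e, r)) - ?h ` labels (upper_ends e)"
    have "v = take l v @ take (upper_ends e) (drop l v) @ drop (l + upper_ends e) v"
      by (metis append_take_drop_id drop_drop add.commute)
    moreover have "take (upper_ends e) (drop l v) \<in> labels (upper_ends e)"
      using v by (auto simp: labels_def)
    ultimately have "\<not> (take l u = take l v \<and> drop (l + lower_ends e) u = drop (l + upper_ends e) v)"
      using v by (metis DiffD2 imageI)
    then show "slice_matrix W (l, e, r) u v * F v = 0" by auto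
  qed simp
  finally show ?thesis by simp
qed

lemma transfer_eq_sum_histories:
  assumes "tangle a T b" "length u = a"
  shows "transfer W T (\<lambda>_. 1) u = (\<Sum>us\<in>histories T. history_weight W T u us)"
  using assms
proof (induction T arbitrary: a u)
  case (Cons s T)
  obtain l e r where s: "s = (l, e, r)" by (cases s)
  have n: "length u = l + lower_ends e + r" and T: "tangle (l + upper_ends e + r) T b"
    using Cons.prems s by auto
  have "transfer W (s # T) (\<lambda>_. 1) u =
      (\<Sum>v\<in>labels (upper_width s). slice_matrix W s u v * transfer W T (\<lambda>_. 1) v)"
    unfolding s using n by (subst sum_slice_matrix) (auto simp: transfer.simps(2))
  also have "\<dots> = (\<Sum>v\<in>labels (upper_width s). \<Sum>us\<in>histories T.
      slice_matrix W s u v * history_weight W T v us)"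
    using Cons.IH[OF T] by (intro sum.cong) (auto simp: s labels_def sum_distrib_left)
  also have "\<dots> = (\<Sum>us\<in>histories (s # T). history_weight W (s # T) u us)"
    by (simp add: sum.reindex inj_on_def sum.cartesian_product case_prod_unfold)
  finally show ?case .
qed simp

lemma histories_iff:
  "us \<in> histories T \<longleftrightarrow> length us = length T \<and> (\<forall>j<length T. length (us ! j) = upper_width (T ! j))"
proof (induction T arbitrary: us)
  case (Cons s T)
  show ?case
    by (cases us) (auto simp: Cons.IH labels_def All_less_Suc2)
qed auto

lemma history_weight_eq_prod:
  "length us = length T \<Longrightarrow>
     history_weight W T u us = (\<Prod>j<length T. slice_matrix W (T ! j) ((u # us) ! j) (us ! j))"
proof (induction T arbitrary: u us)
  case (Cons s T)
  then show ?case
    by (cases us) (auto simp: prod.lessThan_Suc_shift simp del: prod.lessThan_Suc)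
qed simp

lemma tangle_lower_width_0: "tangle a T b \<Longrightarrow> T \<noteq> [] \<Longrightarrow> lower_width (T ! 0) = a"
  by (cases T) auto

lemma tangle_lower_width_Suc:
  "tangle a T b \<Longrightarrow> Suc j < length T \<Longrightarrow> lower_width (T ! Suc j) = upper_width (T ! j)"
proof (induction T arbitrary: a j)
  case (Cons s T)
  obtain l e r where s: "s = (l, e, r)" by (cases s)
  show ?case
    using Cons s tangle_lower_width_0 by (cases j) auto
qed simp

text \<open>Each level of a diagram that carries points lies on top of some slice, because the bottom
  level is empty. So the points can be indexed by the slices below them, without repetition.\<close>

lemma points_diagram:
  assumes "diagram D"
  shows "points D = {(Suc j, p) | j p. j < length D \<and> p < upper_width (D ! j)}"
proof -
  have sp: "slice_points j s = {(j, p) | p. p < lower_width s} \<union> {(Suc j, p) | p. p < upper_width s}" for j s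
    by (cases s) auto
  have "\<exists>i. j = Suc i \<and> p < upper_width (D ! i)" if "j < length D" "p < lower_width (D ! j)" for j p
    using that assms tangle_lower_width_0[of 0 D 0] tangle_lower_width_Suc[of 0 D 0]
    unfolding diagram_def by (cases j) auto
  then show ?thesis
    unfolding points_def sp by fastforce
qed

fun slice_weight :: "(piece \<Rightarrow> bool list \<Rightarrow> bool list \<Rightarrow> 'a::comm_ring_1) \<Rightarrow>
    (point \<Rightarrow> bool) \<Rightarrow> nat \<Rightarrow> slice \<Rightarrow> 'a" where
  "slice_weight W g j (l, e, r) =
     (if \<forall>(p, q)\<in>vertical_strands j (l, e, r). g p = g q
      then W e (map (\<lambda>p. g (j, l + p)) [0..<lower_ends e])
               (map (\<lambda>p. g (Suc j, l + p)) [0..<upper_ends e])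
      else 0)"

definition labellings :: "slice list \<Rightarrow> (point \<Rightarrow> bool) set" where
  "labellings D = (points D \<rightarrow>\<^sub>E UNIV)"

definition row :: "(point \<Rightarrow> bool) \<Rightarrow> nat \<Rightarrow> nat \<Rightarrow> bool list" where
  "row g j n = map (\<lambda>p. g (j, p)) [0..<n]"

lemma length_row [simp]: "length (row g j n) = n"
  by (simp add: row_def)

lemma slice_matrix_row:
  "slice_matrix W s (row g j (lower_width s)) (row g (Suc j) (upper_width s)) = slice_weight W g j s"
proof -
  obtain l e r where s: "s = (l, e, r)" by (cases s)
  have "take l (row g j (l + lower_ends e + r)) = take l (row g (Suc j) (l + upper_ends e + r)) \<longleftrightarrow>
      (\<forall>p<l. g (j, p) = g (Suc j, p))"
    by (auto simp: list_eq_iff_nth_eq row_def)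
  moreover have "drop (l + lower_ends e) (row g j (l + lower_ends e + r)) =
      drop (l + upper_ends e) (row g (Suc j) (l + upper_ends e + r)) \<longleftrightarrow>
      (\<forall>p<r. g (j, l + lower_ends e + p) = g (Suc j, l + upper_ends e + p))"
    by (auto simp: list_eq_iff_nth_eq row_def add.assoc)
  moreover have "take (lower_ends e) (drop l (row g j (l + lower_ends e + r))) =
      map (\<lambda>p. g (j, l + p)) [0..<lower_ends e]"
    "take (upper_ends e) (drop l (row g (Suc j) (l + upper_ends e + r))) =
      map (\<lambda>p. g (Suc j, l + p)) [0..<upper_ends e]"
    by (auto simp: list_eq_iff_nth_eq row_def)
  moreover have "(\<forall>(p, q)\<in>vertical_strands j (l, e, r). g p = g q) \<longleftrightarrow>
     (\<forall>p<l. g (j, p) = g (Suc j, p)) \<and>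
     (\<forall>p<r. g (j, l + lower_ends e + p) = g (Suc j, l + upper_ends e + p))"
    by auto
  ultimately show ?thesis
    by (simp only: s slice_matrix.simps slice_weight.simps lower_width.simps upper_width.simps)
qed

text \<open>Multiplying out the slice matrices gives a sum over histories. The rows of a labelling of the
  points form a history, and for a diagram this is a bijection.\<close>

lemma partition_function_eq_sum_labellings:
  assumes "diagram D"
  shows "partition_function W D =
    (\<Sum>g\<in>labellings D. \<Prod>j<length D. slice_weight W g j (D ! j))"
proof -
  define H where "H g = map (\<lambda>j. row g (Suc j) (upper_width (D ! j))) [0..<length D]" for g
  define G where "G us = restrict (\<lambda>(j, p). us ! (j - 1) ! p) (points D)" for us :: "bool list list"
  have pts: "(Suc j, p) \<in> points D \<longleftrightarrow> j < length D \<and> p < upper_width (D ! j)" for j p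
    unfolding points_diagram[OF assms] by auto
  have low: "([] # H g) ! j = row g j (lower_width (D ! j))" if "j < length D" for g j
    using that assms tangle_lower_width_0[of 0 D 0] tangle_lower_width_Suc[of 0 D 0]
    unfolding diagram_def by (cases j) (auto simp: H_def row_def)
  have len: "length (H g) = length D" for g by (simp add: H_def)
  have HG: "H (G us) = us" if "us \<in> histories D" for us
  proof (rule nth_equalityI)
    show "length (H (G us)) = length us"
      using that by (simp add: histories_iff len)
    fix j assume "j < length (H (G us))"
    then have j: "j < length D" by (simp add: len)
    have "row (G us) (Suc j) (upper_width (D ! j)) = us ! j"
    proof (rule nth_equalityI)
      show "length (row (G us) (Suc j) (upper_width (D ! j))) = length (us ! j)"
        using that j by (simp add: histories_iff)
      fix p assume "p < length (row (G us) (Suc j) (upper_width (D ! j)))"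
      then show "row (G us) (Suc j) (upper_width (D ! j)) ! p = us ! j ! p"
        using j by (simp add: row_def G_def pts)
    qed
    then show "H (G us) ! j = us ! j"
      using j by (simp add: H_def)
  qed
  have "partition_function W D = (\<Sum>us\<in>histories D. history_weight W D [] us)"
    using transfer_eq_sum_histories[of 0 D 0 "[]" W] assms
    by (simp add: partition_function_def diagram_def)
  also have "\<dots> = (\<Sum>g\<in>labellings D. history_weight W D [] (H g))"
  proof (rule sum.reindex_bij_witness[where i = H and j = G], goal_cases)
    case (1 us)
    then show ?case by (rule HG)
  next
    case (2 us)
    then show ?case by (simp add: labellings_def G_def)
  next
    case (3 g)
    have "(\<lambda>(j, p). H g ! (j - 1) ! p) x = g x" if "x \<in> points D" for x
      using that unfolding points_diagram[OF assms] by (auto simp: H_def row_def)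
    moreover have "g \<in> extensional (points D)"
      using 3 by (auto simp: labellings_def PiE_def)
    ultimately show ?case unfolding G_def
      by (intro extensionalityI[of _ "points D"] restrict_extensional)
        (simp_all only: restrict_apply')
  next
    case (4 g)
    then show ?case by (simp add: histories_iff H_def)
  next
    case (5 us)
    then show ?case by (simp add: HG)
  qed
  also have "\<dots> = (\<Sum>g\<in>labellings D. \<Prod>j<length D. slice_weight W g j (D ! j))"
    unfolding history_weight_eq_prod[OF len]
    by (intro sum.cong prod.cong refl, subst low)
       (simp_all add: H_def slice_matrix_row)
  finally show ?thesis .
qed

section \<open>The state sum as a partition function\<close>

text \<open>\<open>pattern_weight\<close> on boolean labels, with the arms as separate arguments. For the over-strand
  \<open>NW_SE\<close> the arguments are permuted as by \<open>turn_labels\<close>.\<close>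

definition corner_weight :: "'a::comm_ring_1 \<Rightarrow> 'a \<Rightarrow> 'a \<Rightarrow> 'a \<Rightarrow> bool \<Rightarrow> bool \<Rightarrow> bool \<Rightarrow> bool \<Rightarrow> 'a" where
  "corner_weight x y z w sw se nw ne =
     (if nw = ne \<and> ne = se \<and> se = sw then x
      else if nw = se \<and> ne = sw then y
      else if nw = ne \<and> sw = se then z
      else if nw = sw \<and> ne = se then w
      else 0)"

definition state_weight :: "'a::comm_ring_1 \<Rightarrow> 'a \<Rightarrow> 'a \<Rightarrow> 'a \<Rightarrow> piece \<Rightarrow> bool list \<Rightarrow> bool list \<Rightarrow> 'a" where
  "state_weight x y z w e u v =
     (case e of
        Cup \<Rightarrow> of_bool (v ! 0 = v ! 1)
      | Cap \<Rightarrow> of_bool (u ! 0 = u ! 1)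
      | Crossing s \<Rightarrow> (case s of
          SW_NE \<Rightarrow> corner_weight x y z w (u ! 0) (u ! 1) (v ! 0) (v ! 1)
        | NW_SE \<Rightarrow> corner_weight x y z w (v ! 0) (u ! 0) (v ! 1) (u ! 1))
      | Vertex _ \<Rightarrow> of_bool (u ! 0 = u ! 1 \<and> u ! 0 = v ! 0 \<and> u ! 0 = v ! 1))"

lemma finite_points: "finite (points D)"
proof -
  have "finite (slice_points j s)" for j s
    by (cases s) auto
  then show ?thesis by (simp add: points_def)
qed

lemma equiv_equiv_generated: "equiv UNIV (equiv_generated R)"
  unfolding equiv_generated_def
proof (rule equivI)
  show "sym ((R \<union> R\<inverse>)\<^sup>*)"
    by (intro sym_rtrancl) (auto simp: sym_def)
qed (auto simp: refl_on_def trans_rtrancl)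

lemma equiv_generated_invariant:
  assumes "(p, q) \<in> equiv_generated R" "\<forall>(p, q)\<in>R. g p = g q"
  shows "g p = g q"
  using assms(1) unfolding equiv_generated_def
  by (induction rule: rtrancl_induct) (use assms(2) in auto)

lemma equiv_generated_base: "R \<subseteq> equiv_generated R"
  unfolding equiv_generated_def by auto

text \<open>This turns states into labellings of the points: a labelling that is invariant under \<open>R\<close> is
  invariant under the generated equivalence relation, and so descends to its classes.\<close>

lemma bij_betw_class_labellings:
  fixes R :: "(point \<times> point) set" and P :: "point set"
  defines "C \<equiv> equiv_generated R"
  assumes R: "R \<subseteq> P \<times> P"
  shows "bij_betw (\<lambda>\<sigma>. restrict (\<lambda>p. \<sigma> (C `` {p}) = (1::nat)) P)
    (P // C \<rightarrow>\<^sub>E {0, 1}) {g \<in> P \<rightarrow>\<^sub>E (UNIV :: bool set). \<forall>(p, q)\<in>R. g p = g q}"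
    (is "bij_betw _ ?S ?G")
proof -
  define lab where "lab \<sigma> = restrict (\<lambda>p. \<sigma> (C `` {p}) = (1::nat)) P" for \<sigma>
  define st where "st g = restrict (\<lambda>K. of_bool (\<exists>p\<in>P \<inter> K. g p) :: nat) (P // C)" for g
  have C: "equiv UNIV C" unfolding C_def by (rule equiv_equiv_generated)
  have classes: "C `` {p} \<in> P // C" if "p \<in> P" for p
    using that by (auto simp: quotient_def)
  have mem: "p \<in> C `` {p}" for p
    by (simp add: C_def equiv_generated_def)
  have eq: "C `` {p} = C `` {q}" if "q \<in> C `` {p}" for p q
    using that C by (simp add: equiv_class_eq)
  have "st (lab \<sigma>) = \<sigma>" if \<sigma>: "\<sigma> \<in> ?S" for \<sigma>
  proof (rule extensionalityI[of _ "P // C"])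
    fix K assume K: "K \<in> P // C"
    then obtain p where p: "p \<in> P" "K = C `` {p}" by (auto simp: quotient_def)
    have "lab \<sigma> r \<longleftrightarrow> \<sigma> K = 1" if "r \<in> P \<inter> K" for r
      using that p(2) eq[of r p] by (simp add: lab_def)
    moreover have "p \<in> P \<inter> K" using p mem[of p] by simp
    ultimately have "(\<exists>p\<in>P \<inter> K. lab \<sigma> p) \<longleftrightarrow> \<sigma> K = 1"
      by blast
    moreover have "\<sigma> K \<in> {0, 1}" using \<sigma> K by auto
    ultimately show "st (lab \<sigma>) K = \<sigma> K"
      using K by (auto simp: st_def)
  qed (use \<sigma> in \<open>auto simp: PiE_def st_def\<close>)
  moreover have "lab (st g) = g" if g: "g \<in> ?G" for g
  proof (rule extensionalityI[of _ P])
    fix p assume p: "p \<in> P"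
    have "g q = g p" if "q \<in> C `` {p}" for q
      using that equiv_generated_invariant[of p q R g] g by (simp add: C_def)
    then have "(\<exists>q\<in>P \<inter> C `` {p}. g q) \<longleftrightarrow> g p"
      using p mem[of p] by blast
    then show "lab (st g) p = g p"
      using p classes by (simp add: lab_def st_def)
  qed (use g in \<open>auto simp: PiE_def lab_def\<close>)
  moreover have "lab ` ?S \<subseteq> ?G"
  proof -
    have "C `` {p} = C `` {q}" if "(p, q) \<in> R" for p q
      using that equiv_generated_base[of R] by (intro eq) (auto simp: C_def)
    then have "lab \<sigma> p = lab \<sigma> q" if "(p, q) \<in> R" for p q \<sigma>
      using that R by (auto simp: lab_def)
    then show ?thesis by (auto simp: lab_def)
  qed
  moreover have "st ` ?G \<subseteq> ?S"
    by (auto simp: st_def)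
  ultimately have "bij_betw lab ?S ?G"
    by (intro bij_betw_byWitness[where f' = st]) auto
  then show ?thesis by (simp only: lab_def[abs_def])
qed

lemma hat_links_subset_points:
  assumes "j < length D"
  shows "hat_links j (D ! j) \<subseteq> points D \<times> points D"
proof -
  obtain l e r where s: "D ! j = (l, e, r)" by (cases "D ! j")
  have "hat_links j (D ! j) \<subseteq> slice_points j (D ! j) \<times> slice_points j (D ! j)"
    unfolding s by (cases e) (auto simp: numeral_2_eq_2)
  then show ?thesis using assms unfolding points_def by blast
qed

lemma UNIV_arm: "(UNIV :: arm set) = {NW, NE, SW, SE}"
  using arm.exhaust by blast

lemma Collect_arm:
  "{a. P a} = (if P NW then {NW} else {}) \<union> (if P NE then {NE} else {}) \<union>
     (if P SW then {SW} else {}) \<union> (if P SE then {SE} else {})"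
  (is "?l = ?r")
proof (rule set_eqI)
  fix a show "a \<in> ?l \<longleftrightarrow> a \<in> ?r" by (cases a) auto
qed

text \<open>Legality takes care of itself in the state sum: a nonzero weight forces the arms to split into
  two pairs of equal labels.\<close>

lemma pattern_weight_nonzeroD:
  assumes "pattern_weight x y z w f' \<noteq> 0" "f' \<in> {f, turn_labels f}"
  shows "even (card {a. f a = b})"
proof -
  have "f NW = f NE \<and> f SW = f SE \<or> f NW = f SE \<and> f NE = f SW \<or> f NW = f SW \<and> f NE = f SE"
    using assms unfolding pattern_weight_def turn_labels_def by (auto split: if_splits)
  then show ?thesis
    unfolding Collect_arm[of "\<lambda>a. f a = b"] by (elim disjE) auto
qed

lemma over_eq: "D ! j = (l, Crossing s, r) \<Longrightarrow> over D j = s"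
  unfolding over_def by auto

lemma crossing_arm_in_points:
  assumes "j \<in> crossings D"
  shows "arm_end D j a \<in> points D"
proof -
  obtain l s r where s: "D ! j = (l, Crossing s, r)" and j: "j < length D"
    using assms by (auto simp: crossings_def)
  then have "arm_end D j a \<in> slice_points j (D ! j)"
    by (cases a) (auto simp: arm_end_def)
  then show ?thesis using j by (auto simp: points_def)
qed

definition label_weight :: "'a::comm_ring_1 \<Rightarrow> 'a \<Rightarrow> 'a \<Rightarrow> 'a \<Rightarrow> slice list \<Rightarrow> (point \<Rightarrow> bool) \<Rightarrow> nat \<Rightarrow> 'a" where
  "label_weight x y z w D g j =
     (let f = (\<lambda>a. of_bool (g (arm_end D j a))) in
      pattern_weight x y z w (case over D j of SW_NE \<Rightarrow> f | NW_SE \<Rightarrow> turn_labels f))"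

lemma finite_crossings [simp]: "finite (crossings D)"
  by (simp add: crossings_def)

lemma upt_0_2: "[0..<2] = [0, Suc 0]"
  by (simp add: numeral_2_eq_2)

lemma slice_weight_state:
  assumes "j < length D"
  shows "slice_weight (state_weight x y z w) g j (D ! j) =
    (if \<forall>(p, q)\<in>hat_links j (D ! j). g p = g q
     then if j \<in> crossings D then label_weight x y z w D g j else 1 else 0)"
proof -
  obtain l e r where s: "D ! j = (l, e, r)" by (cases "D ! j")
  have V: "(\<forall>(p, q)\<in>hat_links j (l, e, r). g p = g q) \<longleftrightarrow>
      (\<forall>(p, q)\<in>vertical_strands j (l, e, r). g p = g q) \<and>
      (\<forall>(p, q)\<in>(case e of
        Cup \<Rightarrow> {((Suc j, l), (Suc j, Suc l))}
      | Cap \<Rightarrow> {((j, l), (j, Suc l))}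
      | Crossing _ \<Rightarrow> {}
      | Vertex _ \<Rightarrow> {((j, l), (j, Suc l)), ((j, l), (Suc j, l)), ((j, l), (Suc j, Suc l))}). g p = g q)"
    by (simp only: hat_links.simps ball_Un)
  have c: "j \<in> crossings D \<longleftrightarrow> (\<exists>t. e = Crossing t)"
    using assms s by (auto simp: crossings_def)
  show ?thesis
  proof (cases "\<forall>(p, q)\<in>vertical_strands j (l, e, r). g p = g q")
    case True
    show ?thesis
    proof (cases e)
      case (Crossing t)
      have "state_weight x y z w e [g (j, l), g (j, Suc l)] [g (Suc j, l), g (Suc j, Suc l)] =
         label_weight x y z w D g j"
        using over_eq[of D j l t r] s Crossing
        by (cases t) (auto simp: state_weight_def label_weight_def corner_weight_def Let_def
            pattern_weight_def turn_labels_def arm_end_def)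
      then show ?thesis
        using True V c Crossing by (simp add: s upt_0_2 del: vertical_strands.simps hat_links.simps)
    qed (use True V c in \<open>auto simp: s upt_0_2 state_weight_def del: vertical_strands.simps hat_links.simps\<close>)
  next
    case False
    then have "\<not> (\<forall>(p, q)\<in>hat_links j (l, e, r). g p = g q)" using V by blast
    then show ?thesis using False by (simp only: s slice_weight.simps if_False)
  qed
qed

lemma state_sum_eq_partition_function:
  assumes "diagram D"
  shows "state_sum D x y z w = partition_function (state_weight x y z w) D"
proof -
  let ?R = "\<Union>j<length D. hat_links j (D ! j)"
  let ?G = "{g \<in> labellings D. \<forall>(p, q)\<in>?R. g p = g q}"
  define lab where "lab \<sigma> = restrict (\<lambda>p. \<sigma> (hat_connected D `` {p}) = (1::nat)) (points D)" for \<sigma>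
  have R: "?R \<subseteq> points D \<times> points D"
    using hat_links_subset_points by blast
  have fin: "finite (labellings D)"
    unfolding labellings_def by (simp add: finite_PiE finite_points)
  have bij: "bij_betw lab (states D) ?G"
    using bij_betw_class_labellings[OF R]
    unfolding lab_def[abs_def] states_def hat_components_def hat_connected_def labellings_def .
  then have fin_states: "finite (states D)"
    using fin bij_betw_finite by fastforce
  have weight: "crossing_weight x y z w D \<sigma> j = label_weight x y z w D (lab \<sigma>) j"
    if "\<sigma> \<in> states D" "j \<in> crossings D" for \<sigma> j
  proof -
    have "arm_label D \<sigma> j a = of_bool (lab \<sigma> (arm_end D j a))" for a
    proof -
      have a: "arm_end D j a \<in> points D"
        using that(2) by (rule crossing_arm_in_points)
      then have "\<sigma> (hat_connected D `` {arm_end D j a}) \<in> {0, 1}"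
        using that(1) by (auto simp: states_def hat_components_def quotient_def)
      then show ?thesis using a by (auto simp: arm_label_def lab_def)
    qed
    then have "arm_label D \<sigma> j = (\<lambda>a. of_bool (lab \<sigma> (arm_end D j a)))" by blast
    then show ?thesis
      by (simp add: crossing_weight_def label_weight_def Let_def split: over_strand.split)
  qed
  have illegal: "(\<Prod>j\<in>crossings D. crossing_weight x y z w D \<sigma> j) = 0" if "\<not> legal D \<sigma>" for \<sigma>
  proof -
    obtain j b where j: "j \<in> crossings D" and odd: "odd (card {a. arm_label D \<sigma> j a = b})"
      using \<open>\<not> legal D \<sigma>\<close> by (auto simp: legal_def)
    have "crossing_weight x y z w D \<sigma> j = 0"
      using odd pattern_weight_nonzeroD[of x y z w _ "arm_label D \<sigma> j" b]
      unfolding crossing_weight_def by (cases "over D j") auto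
    then show ?thesis using j by (auto intro: prod_zero)
  qed
  have "state_sum D x y z w = (\<Sum>\<sigma>\<in>states D. \<Prod>j\<in>crossings D. crossing_weight x y z w D \<sigma> j)"
    unfolding state_sum_def using fin_states illegal by (intro sum.mono_neutral_left) auto
  also have "\<dots> = (\<Sum>\<sigma>\<in>states D. \<Prod>j\<in>crossings D. label_weight x y z w D (lab \<sigma>) j)"
    by (intro sum.cong prod.cong refl weight)
  also have "\<dots> = (\<Sum>g\<in>?G. \<Prod>j\<in>crossings D. label_weight x y z w D g j)"
    by (rule sum.reindex_bij_betw[OF bij])
  also have "\<dots> = (\<Sum>g\<in>labellings D. \<Prod>j<length D. slice_weight (state_weight x y z w) g j (D ! j))"
  proof (intro sum.mono_neutral_cong_left fin ballI)
    fix g assume "g \<in> labellings D - ?G"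
    then obtain j where "j < length D" "\<not> (\<forall>(p, q)\<in>hat_links j (D ! j). g p = g q)"
      by blast
    then show "(\<Prod>j<length D. slice_weight (state_weight x y z w) g j (D ! j)) = 0"
      by (intro prod_zero) (auto intro!: bexI[of _ j] simp: slice_weight_state)
  next
    fix g assume "g \<in> ?G"
    then have "\<forall>(p, q)\<in>hat_links j (D ! j). g p = g q" if "j < length D" for j
      using that by blast
    then have "(\<Prod>j<length D. slice_weight (state_weight x y z w) g j (D ! j)) =
        (\<Prod>j<length D. if j \<in> crossings D then label_weight x y z w D g j else 1)"
      by (intro prod.cong) (simp_all add: slice_weight_state)
    also have "\<dots> = (\<Prod>j\<in>crossings D. label_weight x y z w D g j)"
      by (simp add: prod.If_cases crossings_def Collect_conj_eq lessThan_def)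
    finally show "(\<Prod>j\<in>crossings D. label_weight x y z w D g j) =
        (\<Prod>j<length D. slice_weight (state_weight x y z w) g j (D ! j))" by simp
  qed auto
  also have "\<dots> = partition_function (state_weight x y z w) D"
    using partition_function_eq_sum_labellings[OF assms] by metis
  finally show ?thesis .
qed

section \<open>The self-writhe as a logarithmic derivative\<close>

text \<open>The label of an end says whether the strand points upward there. A crossing contributes
  \<open>exp h\<close> or \<open>exp (- h)\<close> according to its sign. The weight of a marked vertex is that of its
  smoothing: two vertical strands, or a cap below a cup.\<close>

definition writhe_weight :: "real \<Rightarrow> piece \<Rightarrow> bool list \<Rightarrow> bool list \<Rightarrow> real" where
  "writhe_weight h e u v =
     (case e of
        Cup \<Rightarrow> of_bool (v ! 0 \<noteq> v ! 1)
      | Cap \<Rightarrow> of_bool (u ! 0 \<noteq> u ! 1)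
      | Crossing s \<Rightarrow> of_bool (u ! 0 = v ! 1 \<and> u ! 1 = v ! 0) *
          exp (if s = (if u ! 0 = u ! 1 then SW_NE else NW_SE) then h else - h)
      | Vertex Vertical \<Rightarrow> of_bool (u = v)
      | Vertex Horizontal \<Rightarrow> of_bool (u ! 0 \<noteq> u ! 1 \<and> v ! 0 \<noteq> v ! 1))"

text \<open>Rewriting rules in which only the terms of nonzero weight remain, so that evaluating a concrete
  tangle does not run through all labellings.\<close>

lemma transfer_writhe:
  "transfer (writhe_weight h) ((l, Cup, r) # T) f u =
     transfer (writhe_weight h) T f (take l u @ [False, True] @ drop l u) +
     transfer (writhe_weight h) T f (take l u @ [True, False] @ drop l u)"
  "l + 2 \<le> length u \<Longrightarrow> transfer (writhe_weight h) ((l, Cap, r) # T) f u =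
     (if u ! l = u ! Suc l then 0 else transfer (writhe_weight h) T f (take l u @ drop (l + 2) u))"
  "l + 2 \<le> length u \<Longrightarrow> transfer (writhe_weight h) ((l, Vertex Vertical, r) # T) f u =
     transfer (writhe_weight h) T f u"
  "l + 2 \<le> length u \<Longrightarrow> transfer (writhe_weight h) ((l, Vertex Horizontal, r) # T) f u =
     (if u ! l = u ! Suc l then 0 else
       transfer (writhe_weight h) T f (take l u @ [False, True] @ drop (l + 2) u) +
       transfer (writhe_weight h) T f (take l u @ [True, False] @ drop (l + 2) u))"
  "l + 2 \<le> length u \<Longrightarrow> transfer (writhe_weight h) ((l, Crossing s, r) # T) f u =
     exp (if s = (if u ! l = u ! Suc l then SW_NE else NW_SE) then h else - h) *
     transfer (writhe_weight h) T f (take l u @ [u ! Suc l, u ! l] @ drop (l + 2) u)"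
proof -
  have [simp]: "P (take l u @ a # b # drop (Suc (Suc l)) u) = P u"
    if "l + 2 \<le> length u" "a = u ! l" "b = u ! Suc l" for a b and P :: "bool list \<Rightarrow> real"
    using that by (simp add: Cons_nth_drop_Suc)
  have [simp]: "take 2 (drop l u) = [u ! l, u ! Suc l]" if "l + 2 \<le> length u"
    using that by (simp add: numeral_2_eq_2 Cons_nth_drop_Suc[symmetric] take_Suc)
  show "transfer (writhe_weight h) ((l, Cup, r) # T) f u =
     transfer (writhe_weight h) T f (take l u @ [False, True] @ drop l u) +
     transfer (writhe_weight h) T f (take l u @ [True, False] @ drop l u)"
    by (simp add: transfer.simps(2) sum_labels writhe_weight_def)
  assume l: "l + 2 \<le> length u"
  show "transfer (writhe_weight h) ((l, Cap, r) # T) f u =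
     (if u ! l = u ! Suc l then 0 else transfer (writhe_weight h) T f (take l u @ drop (l + 2) u))"
    using l by (simp add: transfer.simps(2) sum_labels writhe_weight_def)
  show "transfer (writhe_weight h) ((l, Vertex Vertical, r) # T) f u =
     transfer (writhe_weight h) T f u"
    using l by (cases "u ! l"; cases "u ! Suc l") (simp_all add: transfer.simps(2) sum_labels writhe_weight_def)
  show "transfer (writhe_weight h) ((l, Vertex Horizontal, r) # T) f u =
     (if u ! l = u ! Suc l then 0 else
       transfer (writhe_weight h) T f (take l u @ [False, True] @ drop (l + 2) u) +
       transfer (writhe_weight h) T f (take l u @ [True, False] @ drop (l + 2) u))"
    using l by (simp add: transfer.simps(2) sum_labels writhe_weight_def)
  show "transfer (writhe_weight h) ((l, Crossing s, r) # T) f u =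
     exp (if s = (if u ! l = u ! Suc l then SW_NE else NW_SE) then h else - h) *
     transfer (writhe_weight h) T f (take l u @ [u ! Suc l, u ! l] @ drop (l + 2) u)"
    using l by (cases "u ! l"; cases "u ! Suc l")
      (simp_all add: transfer.simps(2) sum_labels writhe_weight_def)
qed

definition link_diagram :: "slice list \<Rightarrow> bool" where
  "link_diagram L \<longleftrightarrow> diagram L \<and> (\<forall>l m r. (l, Vertex m, r) \<notin> set L)"

definition orientations :: "slice list \<Rightarrow> (point \<Rightarrow> bool) set" where
  "orientations L = {g \<in> labellings L. link_orientation L g}"

definition total_writhe :: "slice list \<Rightarrow> (point \<Rightarrow> bool) \<Rightarrow> int" where
  "total_writhe L up = (\<Sum>j\<in>crossings L. crossing_sign L up j)"

lemma finite_orientations: "finite (orientations L)"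
  unfolding orientations_def labellings_def by (simp add: finite_PiE finite_points)

lemma slice_weight_writhe:
  assumes "j < length L" "\<And>l m r. L ! j \<noteq> (l, Vertex m, r)"
  shows "slice_weight (writhe_weight h) g j (L ! j) =
    (if slice_orientation g j (L ! j)
     then if j \<in> crossings L then exp (h * crossing_sign L g j) else 1 else 0)"
proof -
  obtain l e r where s: "L ! j = (l, e, r)" by (cases "L ! j")
  have c: "j \<in> crossings L \<longleftrightarrow> (\<exists>t. e = Crossing t)"
    using assms s by (auto simp: crossings_def)
  show ?thesis
  proof (cases "\<forall>(p, q)\<in>vertical_strands j (l, e, r). g p = g q")
    case True
    show ?thesis
    proof (cases e)
      case (Crossing t)
      have "writhe_weight h e [g (j, l), g (j, Suc l)] [g (Suc j, l), g (Suc j, Suc l)] =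
         (if g (j, l) = g (Suc j, Suc l) \<and> g (j, Suc l) = g (Suc j, l)
          then exp (h * crossing_sign L g j) else 0)"
        using over_eq[of L j l t r] s Crossing
        by (cases t) (simp_all add: writhe_weight_def crossing_sign_def arm_end_def)
      then show ?thesis
        using True c Crossing by (simp add: s upt_0_2 del: vertical_strands.simps)
    qed (use True c assms in \<open>auto simp: s upt_0_2 writhe_weight_def simp del: vertical_strands.simps\<close>)
  next
    case False
    then show ?thesis by (simp only: s slice_weight.simps slice_orientation.simps if_False simp_thms)
  qed
qed

lemma writhe_partition_function:
  assumes "link_diagram L"
  shows "partition_function (writhe_weight h) L =
    (\<Sum>g\<in>orientations L. exp (h * total_writhe L g))"
proof -
  have "diagram L" using assms by (simp add: link_diagram_def)
  have nv: "L ! j \<noteq> (l, Vertex m, r)" if "j < length L" for j l m r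
    using assms that unfolding link_diagram_def by (metis nth_mem)
  have "partition_function (writhe_weight h) L =
      (\<Sum>g\<in>labellings L. \<Prod>j<length L. slice_weight (writhe_weight h) g j (L ! j))"
    by (rule partition_function_eq_sum_labellings[OF \<open>diagram L\<close>])
  also have "\<dots> = (\<Sum>g\<in>orientations L. exp (h * total_writhe L g))"
  proof (intro sum.mono_neutral_cong_right ballI)
    show "finite (labellings L)"
      unfolding labellings_def by (simp add: finite_PiE finite_points)
    fix g assume "g \<in> labellings L - orientations L"
    then obtain j where "j < length L" "\<not> slice_orientation g j (L ! j)"
      by (auto simp: orientations_def link_orientation_def)
    then show "(\<Prod>j<length L. slice_weight (writhe_weight h) g j (L ! j)) = 0"
      by (intro prod_zero) (auto intro!: bexI[of _ j] simp: slice_weight_writhe nv)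
  next
    fix g assume "g \<in> orientations L"
    then have "slice_orientation g j (L ! j)" if "j < length L" for j
      using that by (simp add: orientations_def link_orientation_def)
    then have "(\<Prod>j<length L. slice_weight (writhe_weight h) g j (L ! j)) =
        (\<Prod>j<length L. if j \<in> crossings L then exp (h * crossing_sign L g j) else 1)"
      by (intro prod.cong) (simp_all add: slice_weight_writhe nv)
    also have "\<dots> = (\<Prod>j\<in>crossings L. exp (h * crossing_sign L g j))"
      by (simp add: prod.If_cases crossings_def Collect_conj_eq lessThan_def)
    also have "\<dots> = exp (h * total_writhe L g)"
      by (simp add: total_writhe_def exp_sum sum_distrib_left)
    finally show "(\<Prod>j<length L. slice_weight (writhe_weight h) g j (L ! j)) =
        exp (h * total_writhe L g)" .
  qed (auto simp: orientations_def)
  finally show ?thesis .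
qed

lemma transfer_writhe_nonneg: "transfer (writhe_weight h) T (\<lambda>_. 1) u \<ge> 0"
proof -
  have "writhe_weight h e u v \<ge> 0" for e u v
    by (auto simp: writhe_weight_def split: piece.split marker.split)
  moreover have "transfer W T f u \<ge> 0" if "\<And>e u v. W e u v \<ge> 0" "\<And>u. f u \<ge> 0"
    for W :: "piece \<Rightarrow> bool list \<Rightarrow> bool list \<Rightarrow> real" and f
    using that by (induction W T f u rule: transfer.induct) (auto simp: transfer.simps(2) intro!: sum_nonneg)
  ultimately show ?thesis by simp
qed

text \<open>Existence of orientations, by sweeping from the bottom upward. Each strand end on the current
  level belongs to an arc of the part below; the two ends of the \<open>i\<close>-th arc carry the tokens
  \<open>(i, True)\<close> and \<open>(i, False)\<close>. Orienting the \<open>i\<close>-th arc by the boolean \<open>c i\<close> makes the end with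
  token \<open>(i, b)\<close> point upward iff \<open>c i = b\<close>. As the tokens are distinct, the two ends of an arc
  are never oriented alike, and a suitable \<open>c\<close> can be continued up to the top: a cup starts a new
  arc, a crossing exchanges two tokens, and a cap either closes an arc, which is consistent by
  distinctness, or concatenates two arcs.\<close>

lemma transfer_writhe_positive:
  assumes "tangle a T 0" "\<forall>l m r. (l, Vertex m, r) \<notin> set T" "distinct ms" "length ms = a"
  shows "\<exists>c :: nat \<Rightarrow> bool. transfer (writhe_weight h) T (\<lambda>_. 1) (map (\<lambda>(i, b). c i = b) ms) > 0"
  using assms
proof (induction T arbitrary: a ms)
  case (Cons s T)
  let ?ev = "\<lambda>c. map (\<lambda>(i, b). c i = b) :: (nat \<times> bool) list \<Rightarrow> bool list"
  let ?Z = "\<lambda>T u. transfer (writhe_weight h) T (\<lambda>_. 1) u"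
  obtain l e r where s: "s = (l, e, r)" by (cases s)
  have n: "length ms = l + lower_ends e + r" and T: "tangle (l + upper_ends e + r) T 0"
    and nv: "\<forall>l m r. (l, Vertex m, r) \<notin> set T"
    using Cons.prems s by auto
  note IH = Cons.IH[OF T nv]
  show ?case
  proof (cases e)
    case Cup
    obtain k where k: "k \<notin> fst ` set ms"
      using ex_new_if_finite[of "fst ` set ms"] by auto
    have "distinct (take l ms @ [(k, True), (k, False)] @ drop l ms)"
    proof -
      have "(k, b) \<notin> set ms" for b using k by force
      then show ?thesis
        using Cons.prems(3) set_take_disj_set_drop_if_distinct[of ms l l]
        by (auto dest: in_set_takeD in_set_dropD)
    qed
    then obtain c where "?Z T (?ev c (take l ms @ [(k, True), (k, False)] @ drop l ms)) > 0"
      using IH[of "take l ms @ [(k, True), (k, False)] @ drop l ms"] n Cup by auto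
    then have "?Z T (take l (?ev c ms) @ [False, True] @ drop l (?ev c ms)) > 0 \<or>
        ?Z T (take l (?ev c ms) @ [True, False] @ drop l (?ev c ms)) > 0"
      by (cases "c k") (simp_all add: take_map drop_map)
    then have "?Z (s # T) (?ev c ms) > 0"
      unfolding s Cup transfer_writhe(1)
      using transfer_writhe_nonneg add_nonneg_pos add_pos_nonneg by metis
    then show ?thesis by blast
  next
    case Cap
    define A x y B where "A = take l ms" and "x = ms ! l" and "y = ms ! Suc l" and "B = drop (l + 2) ms"
    have ms: "ms = A @ x # y # B" and lA: "length A = l"
      using n Cap by (simp_all add: A_def x_def y_def B_def Cons_nth_drop_Suc)
    obtain i b j b' where x: "x = (i, b)" and y: "y = (j, b')" by (cases x; cases y)
    have dist: "distinct (A @ B)" "x \<notin> set (A @ B)" "y \<notin> set (A @ B)" "x \<noteq> y"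
      using Cons.prems(3) unfolding ms by auto
    have step: "?Z (s # T) (?ev c ms) = ?Z T (?ev c (A @ B))" if "(c i = b) \<noteq> (c j = b')" for c
      using that unfolding s Cap ms x y
      by (subst transfer_writhe(2)) (auto simp: lA[symmetric] nth_append)
    have len: "length (A @ B) = l + upper_ends e + r"
      using n Cap by (simp add: A_def B_def)
    show ?thesis
    proof (cases "i = j")
      case True
      then have "b \<noteq> b'" using dist(4) x y by auto
      with step True show ?thesis using IH[OF dist(1) len] by fastforce
    next
      case False
      \<comment> \<open>The cap joins two arcs: the other end of the \<open>j\<close>-th arc inherits
      the token \<open>x\<close>, which has just become free.\<close>
      let ?f = "\<lambda>z. if z = (j, \<not> b') then x else z"
      have "inj_on ?f (set (A @ B))"
        using dist(2) by (auto simp: inj_on_def)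
      then have "distinct (map ?f (A @ B))"
        using dist(1) by (simp only: distinct_map)
      then obtain c where c: "?Z T (?ev c (map ?f (A @ B))) > 0"
        using IH[of "map ?f (A @ B)"] len by auto
      \<comment> \<open>The orientation of the joined arc determines that of its \<open>j\<close>-th part.\<close>
      define c' where "c' = c(j := (if c i = b then \<not> b' else b'))"
      have ev: "?ev c' (A @ B) = ?ev c (map ?f (A @ B))"
      proof -
        have "(case z of (i, b) \<Rightarrow> c' i = b) = (case ?f z of (i, b) \<Rightarrow> c i = b)" if "z \<in> set (A @ B)" for z
        proof -
          have "z \<noteq> (j, b')" using that dist(3) y by auto
          then show ?thesis using x False by (cases z) (auto simp: c'_def)
        qed
        then show ?thesis unfolding map_map o_def by (rule map_cong[OF refl])
      qed
      have "(c' i = b) \<noteq> (c' j = b')"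
        using False by (auto simp: c'_def)
      then have "?Z (s # T) (?ev c' ms) = ?Z T (?ev c (map ?f (A @ B)))"
        unfolding ev[symmetric] by (rule step)
      then have "?Z (s # T) (?ev c' ms) > 0"
        using c by (simp only:)
      then show ?thesis by blast
    qed
  next
    case (Crossing t)
    let ?ms = "take l ms @ [ms ! Suc l, ms ! l] @ drop (l + 2) ms"
    have eq: "ms = take l ms @ ms ! l # ms ! Suc l # drop (l + 2) ms"
      using n Crossing by (simp add: Cons_nth_drop_Suc)
    have "distinct ?ms"
      using Cons.prems(3) by (subst (asm) eq) auto
    then obtain c where "?Z T (?ev c ?ms) > 0"
      using IH[of ?ms] n Crossing by auto
    then have "?Z (s # T) (?ev c ms) > 0"
      using n Crossing by (simp add: s transfer_writhe take_map drop_map)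
    then show ?thesis by blast
  qed (use Cons.prems(2) s in auto)
qed simp

lemma orientations_nonempty:
  assumes "link_diagram L"
  shows "orientations L \<noteq> {}"
  using transfer_writhe_positive[of 0 L "[]" 0] writhe_partition_function[OF assms, of 0] assms
  by (auto simp: link_diagram_def diagram_def partition_function_def)

abbreviation link_connected :: "slice list \<Rightarrow> (point \<times> point) set" where
  "link_connected L \<equiv> equiv_generated (\<Union>j<length L. link_links j (L ! j))"

text \<open>If of the two ends of each link of a slice both or none are reversed, the conditions at the
  slice persist; so an orientation can be reversed on a whole component.\<close>

lemma slice_orientation_flip:
  assumes up: "slice_orientation up j s"
    and same: "\<And>p q. (p, q) \<in> link_links j s \<Longrightarrow> (up' p = up p) = (up' q = up q)"
  shows "slice_orientation up' j s"
proof -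
  obtain l e r where s: "s = (l, e, r)" by (cases s)
  have "up' p = up' q" if "(p, q) \<in> vertical_strands j (l, e, r)" for p q
  proof -
    have "up p = up q" using up that unfolding s slice_orientation.simps by blast
    then show ?thesis using same[of p q] that unfolding s link_links.simps by blast
  qed
  moreover have "case e of
        Cup \<Rightarrow> up' (Suc j, l) \<noteq> up' (Suc j, Suc l)
      | Cap \<Rightarrow> up' (j, l) \<noteq> up' (j, Suc l)
      | Crossing _ \<Rightarrow> up' (j, l) = up' (Suc j, Suc l) \<and> up' (j, Suc l) = up' (Suc j, l)
      | Vertex _ \<Rightarrow> True"
  proof (cases e)
    case Cup
    then show ?thesis
      using up same[of "(Suc j, l)" "(Suc j, Suc l)"] unfolding s by auto
  next
    case Cap
    then show ?thesis
      using up same[of "(j, l)" "(j, Suc l)"] unfolding s by auto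
  next
    case (Crossing t)
    then show ?thesis
      using up same[of "(j, l)" "(Suc j, Suc l)"] same[of "(j, Suc l)" "(Suc j, l)"]
      unfolding s by auto
  qed simp
  ultimately show ?thesis unfolding s slice_orientation.simps by blast
qed

lemma crossing_sign_eq:
  assumes "(up (arm_end L j SW) = up' (arm_end L j SW)) = (up (arm_end L j SE) = up' (arm_end L j SE))"
  shows "crossing_sign L up j = crossing_sign L up' j"
  using assms unfolding crossing_sign_def by auto

lemma crossing_sign_uminus:
  assumes "(up (arm_end L j SW) = up' (arm_end L j SW)) \<noteq> (up (arm_end L j SE) = up' (arm_end L j SE))"
  shows "crossing_sign L up j = - crossing_sign L up' j"
  using assms over_strand.exhaust[of "over L j"] unfolding crossing_sign_def by auto

definition self_crossings :: "slice list \<Rightarrow> nat set" where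
  "self_crossings L = {j \<in> crossings L. (arm_end L j SW, arm_end L j SE) \<in> link_connected L}"

lemma slice_orientations_agree:
  assumes "slice_orientation up j s" "slice_orientation up' j s" "(p, q) \<in> link_links j s"
  shows "(up p = up' p) = (up q = up' q)"
proof -
  obtain l e r where s: "s = (l, e, r)" by (cases s)
  show ?thesis
    using assms unfolding s by (cases e) auto
qed

text \<open>Two orientations agree either everywhere or nowhere on a component, and reversing both strands
  of a crossing preserves its sign.\<close>

lemma self_crossing_sign_unique:
  assumes "link_orientation L up" "link_orientation L up'" "j \<in> self_crossings L"
  shows "crossing_sign L up j = crossing_sign L up' j"
proof (rule crossing_sign_eq)
  have "(up p = up' p) = (up q = up' q)" if "i < length L" "(p, q) \<in> link_links i (L ! i)" for i p q
    using slice_orientations_agree[OF _ _ that(2)] assms(1,2) that(1)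
    unfolding link_orientation_def by blast
  then have "\<forall>(p, q)\<in>(\<Union>i<length L. link_links i (L ! i)). (up p = up' p) = (up q = up' q)"
    by blast
  from equiv_generated_invariant[OF _ this] assms(3)
  show "(up (arm_end L j SW) = up' (arm_end L j SW)) = (up (arm_end L j SE) = up' (arm_end L j SE))"
    unfolding self_crossings_def by blast
qed

lemma self_writhe_eq:
  assumes "link_orientation L up"
  shows "self_writhe L = (\<Sum>j\<in>self_crossings L. crossing_sign L up j)"
proof -
  define up0 where "up0 = (SOME up. link_orientation L up)"
  have up0: "link_orientation L up0"
    unfolding up0_def using assms by (rule someI[of "link_orientation L"])
  let ?E = "link_connected L"
  have E: "equiv UNIV ?E" by (rule equiv_equiv_generated)
  have comps: "{K \<in> link_components L. arm_end L j SW \<in> K \<and> arm_end L j SE \<in> K} =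
      (if j \<in> self_crossings L then {?E `` {arm_end L j SW}} else {})" if j: "j \<in> crossings L" for j
  proof -
    let ?C = "?E `` {arm_end L j SW}"
    have "K = ?E `` {p}" if "K \<in> link_components L" "p \<in> K" for K p
      using that E unfolding link_components_def quotient_def
      by (auto dest: equiv_class_eq)
    moreover have "?C \<in> link_components L"
      using crossing_arm_in_points[OF j] by (auto simp: link_components_def quotient_def)
    moreover have "arm_end L j SW \<in> ?C"
      by (simp add: equiv_generated_def)
    moreover have "j \<in> self_crossings L \<longleftrightarrow> arm_end L j SE \<in> ?C"
      using j by (simp add: self_crossings_def)
    ultimately have "K \<in> link_components L \<and> arm_end L j SW \<in> K \<and> arm_end L j SE \<in> K \<longleftrightarrow>
        K = ?C \<and> j \<in> self_crossings L" for K
      by blast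
    then show ?thesis by simp
  qed
  have fin: "finite (link_components L)"
    unfolding link_components_def quotient_def using finite_points by simp
  have "self_writhe L = (\<Sum>K\<in>link_components L.
      \<Sum>j | j \<in> crossings L \<and> arm_end L j SW \<in> K \<and> arm_end L j SE \<in> K. crossing_sign L up0 j)"
    by (simp add: self_writhe_def up0_def Let_def)
  also have "\<dots> = (\<Sum>j\<in>crossings L.
      \<Sum>K | K \<in> link_components L \<and> arm_end L j SW \<in> K \<and> arm_end L j SE \<in> K. crossing_sign L up0 j)"
    by (rule sum.swap_restrict) (simp_all add: fin)
  also have "\<dots> = (\<Sum>j\<in>crossings L. if j \<in> self_crossings L then crossing_sign L up0 j else 0)"
    by (intro sum.cong refl) (simp add: comps)
  also have "\<dots> = (\<Sum>j\<in>self_crossings L. crossing_sign L up0 j)"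
    by (intro sum.mono_neutral_cong_right) (auto simp: self_crossings_def)
  also have "\<dots> = (\<Sum>j\<in>self_crossings L. crossing_sign L up j)"
    by (intro sum.cong refl self_crossing_sign_unique[OF up0 assms])
  finally show ?thesis .
qed

lemma link_links_subset_points:
  assumes "j < length D"
  shows "link_links j (D ! j) \<subseteq> points D \<times> points D"
proof -
  obtain l e r where s: "D ! j = (l, e, r)" by (cases "D ! j")
  have "link_links j (D ! j) \<subseteq> slice_points j (D ! j) \<times> slice_points j (D ! j)"
    unfolding s by (cases e) (auto simp: numeral_2_eq_2)
  then show ?thesis using assms unfolding points_def by blast
qed

text \<open>Reversing the component through the SW arm is an involution on the orientations. It keeps the
  other strand of the crossing and hence changes the sign.\<close>

lemma sum_mixed_crossing_sign:
  assumes j: "j \<in> crossings L" "j \<notin> self_crossings L"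
  shows "(\<Sum>g\<in>orientations L. crossing_sign L g j) = 0"
proof -
  let ?E = "link_connected L"
  define flip where "flip g = restrict (\<lambda>p. g p \<noteq> ((arm_end L j SW, p) \<in> ?E)) (points L)" for g
  have same: "(arm_end L j SW, p) \<in> ?E \<longleftrightarrow> (arm_end L j SW, q) \<in> ?E"
    if "(p, q) \<in> link_links i (L ! i)" "i < length L" for p q i
  proof -
    have "(p, q) \<in> ?E" using that equiv_generated_base by fastforce
    then show ?thesis
      using equiv_equiv_generated[of "\<Union>j<length L. link_links j (L ! j)"]
      by (meson equivE symD transD)
  qed
  have flip_or: "flip g \<in> orientations L" if g: "g \<in> orientations L" for g
  proof -
    have "slice_orientation (flip g) i (L ! i)" if i: "i < length L" for i
    proof (rule slice_orientation_flip)
      show "slice_orientation g i (L ! i)"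
        using g i by (simp add: orientations_def link_orientation_def)
      fix p q assume pq: "(p, q) \<in> link_links i (L ! i)"
      then show "(flip g p = g p) = (flip g q = g q)"
        using link_links_subset_points[OF i] same[OF pq i] by (auto simp: flip_def)
    qed
    then show ?thesis
      by (simp add: orientations_def link_orientation_def labellings_def flip_def)
  qed
  have flip_flip: "flip (flip g) = g" if g: "g \<in> orientations L" for g
    using g by (intro extensionalityI[of _ "points L"])
      (auto simp: flip_def orientations_def labellings_def PiE_def)
  have "crossing_sign L (flip g) j = - crossing_sign L g j" for g
    using j crossing_arm_in_points[OF j(1)]
    by (intro crossing_sign_uminus) (auto simp: flip_def self_crossings_def equiv_generated_def)
  then have "(\<Sum>g\<in>orientations L. crossing_sign L g j) = (\<Sum>g\<in>orientations L. - crossing_sign L g j)"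
    by (intro sum.reindex_bij_witness[of _ flip flip]) (simp_all add: flip_or flip_flip)
  then show ?thesis by (simp add: sum_negf)
qed

lemma sum_total_writhe:
  "(\<Sum>g\<in>orientations L. total_writhe L g) = int (card (orientations L)) * self_writhe L"
proof -
  have "(\<Sum>g\<in>orientations L. total_writhe L g) =
      (\<Sum>j\<in>crossings L. \<Sum>g\<in>orientations L. crossing_sign L g j)"
    unfolding total_writhe_def by (rule sum.swap)
  also have "\<dots> = (\<Sum>j\<in>self_crossings L. \<Sum>g\<in>orientations L. crossing_sign L g j)"
    by (intro sum.mono_neutral_right) (auto simp: self_crossings_def sum_mixed_crossing_sign)
  also have "\<dots> = (\<Sum>g\<in>orientations L. \<Sum>j\<in>self_crossings L. crossing_sign L g j)"
    by (rule sum.swap)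
  also have "\<dots> = (\<Sum>g\<in>orientations L. self_writhe L)"
    by (intro sum.cong refl) (simp add: self_writhe_eq[symmetric] orientations_def)
  finally show ?thesis by simp
qed

lemma writhe_partition_function_derivative:
  assumes "link_diagram L"
  shows "partition_function (writhe_weight 0) L > 0" (is ?pos)
    and "((\<lambda>h. partition_function (writhe_weight h) L) has_real_derivative
       partition_function (writhe_weight 0) L * self_writhe L) (at 0)"
proof -
  have Z0: "partition_function (writhe_weight 0) L = card (orientations L)"
    by (simp add: writhe_partition_function[OF assms])
  show ?pos
    using orientations_nonempty[OF assms] by (simp add: Z0 card_gt_0_iff finite_orientations)
  have "((\<lambda>h. \<Sum>g\<in>orientations L. exp (h * total_writhe L g)) has_real_derivative
      (\<Sum>g\<in>orientations L. real_of_int (total_writhe L g))) (at 0)"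
    by (auto intro!: derivative_eq_intros)
  also have "(\<Sum>g\<in>orientations L. real_of_int (total_writhe L g)) =
      real_of_int (\<Sum>g\<in>orientations L. total_writhe L g)" by simp
  finally show "((\<lambda>h. partition_function (writhe_weight h) L) has_real_derivative
       partition_function (writhe_weight 0) L * self_writhe L) (at 0)"
    by (simp only: writhe_partition_function[OF assms] sum_total_writhe) (simp add: Z0)
qed

section \<open>Positive resolution\<close>

lemma positive_resolution_simps:
  "positive_resolution [] = []"
  "positive_resolution (s # D) = smooth s @ positive_resolution D"
  by (simp_all add: positive_resolution_def)

lemma tangle_positive_resolution: "tangle a D b \<Longrightarrow> tangle a (positive_resolution D) b"
proof (induction D arbitrary: a)
  case (Cons s D)
  obtain l e r where s: "s = (l, e, r)" by (cases s)
  have "tangle a (smooth s) (l + upper_ends e + r)"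
    using Cons.prems marker.exhaust unfolding s by (cases "(l, e, r)" rule: smooth.cases) auto
  then show ?case
    using Cons unfolding s by (auto simp: positive_resolution_simps tangle_append)
qed (simp add: positive_resolution_simps)

lemma link_diagram_positive_resolution:
  assumes "diagram D"
  shows "link_diagram (positive_resolution D)"
proof -
  have "(l, Vertex m, r) \<notin> set (smooth s)" for l m r s
    by (cases s rule: smooth.cases) auto
  then show ?thesis
    using assms tangle_positive_resolution
    by (auto simp: link_diagram_def diagram_def positive_resolution_def)
qed

text \<open>The weights of marked vertices were chosen so that smoothing does not change the operator.\<close>

lemma transfer_positive_resolution:
  assumes "tangle a D b" "length u = a"
  shows "transfer (writhe_weight h) (positive_resolution D) f u = transfer (writhe_weight h) D f u"
  using assms
proof (induction D arbitrary: a u)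
  case (Cons s D)
  let ?W = "writhe_weight h"
  obtain l e r where s: "s = (l, e, r)" by (cases s)
  have n: "length u = l + lower_ends e + r" and D: "tangle (l + upper_ends e + r) D b"
    using Cons.prems s by auto
  have IH: "transfer ?W (positive_resolution D) f v = transfer ?W D f v"
    if "length v = l + upper_ends e + r" for v
    using Cons.IH[OF D that] .
  have regular: "transfer ?W (s # positive_resolution D) f u = transfer ?W (s # D) f u"
    using n unfolding s
    by (auto simp: transfer.simps(2) labels_def intro!: sum.cong arg_cong2[where f = times] IH)
  show ?case
  proof (cases e)
    case (Vertex m)
    show ?thesis
    proof (cases m)
      case Vertical
      then show ?thesis
        using n Vertex IH by (simp add: s positive_resolution_simps transfer_writhe)
    next
      case Horizontal
      then show ?thesis
        using n Vertex IH by (simp add: s positive_resolution_simps transfer_writhe)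
    qed
  qed (use regular in \<open>simp_all add: s positive_resolution_simps\<close>)
qed (simp add: positive_resolution_simps)

lemma t_plus_derivative:
  assumes "diagram D"
  shows "partition_function (writhe_weight 0) D > 0"
    and "((\<lambda>h. partition_function (writhe_weight h) D) has_real_derivative
       partition_function (writhe_weight 0) D * t_plus D) (at 0)"
proof -
  have "partition_function (writhe_weight h) (positive_resolution D) =
      partition_function (writhe_weight h) D" for h
    unfolding partition_function_def
    by (rule transfer_positive_resolution) (use assms in \<open>simp_all add: diagram_def\<close>)
  then show "partition_function (writhe_weight 0) D > 0"
    and "((\<lambda>h. partition_function (writhe_weight h) D) has_real_derivative
       partition_function (writhe_weight 0) D * t_plus D) (at 0)"
    using writhe_partition_function_derivative[OF link_diagram_positive_resolution[OF assms]]
    by (simp_all add: t_plus_def)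
qed

text \<open>Differentiate both sides of the assumption at \<open>h = 0\<close> and divide by the positive value there.\<close>

lemma t_plus_shift:
  assumes D: "diagram D" "diagram D'"
    and Z: "\<And>h. partition_function (writhe_weight h) D' =
      c * exp (h * of_int k) * partition_function (writhe_weight h) D"
  shows "t_plus D' = t_plus D + k"
proof -
  let ?Z = "\<lambda>h. partition_function (writhe_weight h)"
  have Z0: "?Z 0 D' = c * ?Z 0 D" using Z[of 0] by simp
  have "((\<lambda>h. c * exp (h * of_int k) * ?Z h D) has_real_derivative ?Z 0 D' * (t_plus D + k)) (at 0)"
    by (rule derivative_eq_intros t_plus_derivative(2)[OF D(1)] refl)+ (simp add: Z0 algebra_simps)
  then have "?Z 0 D' * (t_plus D + k) = ?Z 0 D' * t_plus D'"
    using DERIV_unique t_plus_derivative(2)[OF D(2)] Z by (metis (no_types, lifting) ext)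
  then have "real_of_int (t_plus D + k) = t_plus D'"
    using t_plus_derivative(1)[OF D(2)] by simp
  then show ?thesis by linarith
qed

section \<open>Local equivalence and the invariant\<close>

text \<open>A constant of its own, so that the simplifier treats it as an atom whose square is \<open>1 / 2\<close>.\<close>

definition inv_sqrt2 :: complex where
  "inv_sqrt2 = 1 / complex_of_real (sqrt 2)"

definition Q_weight :: "piece \<Rightarrow> bool list \<Rightarrow> bool list \<Rightarrow> complex" where
  "Q_weight = state_weight inv_sqrt2 inv_sqrt2 (\<i> * inv_sqrt2) (- (\<i> * inv_sqrt2))"

definition zeta :: complex where
  "zeta = (1 + \<i>) * inv_sqrt2"

lemma Q_inv_eq:
  assumes "diagram D"
  shows "Q_inv D = zeta powi t_plus D * partition_function Q_weight D"
  unfolding Q_inv_def state_sum_eq_partition_function[OF assms]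
  by (simp add: zeta_def Q_weight_def inv_sqrt2_def)

text \<open>The operators of the state sum and of the writhe model may both change by a factor, provided
  that the changes of the two factors of \<open>Q\<close> cancel. The constant \<open>c\<close> counts the orientations of
  split-off circles and is invisible in the logarithmic derivative.\<close>

definition Q_equivalent :: "nat \<Rightarrow> slice list \<Rightarrow> slice list \<Rightarrow> bool" where
  "Q_equivalent n T T' \<longleftrightarrow>
     (\<exists>a c k. proportional Q_weight n a T T' \<and>
        (\<forall>h. proportional (writhe_weight h) n (c * exp (h * of_int k)) T T') \<and>
        zeta powi k * a = 1)"

lemma Q_equivalentI:
  assumes "proportional Q_weight n 1 T T'" "\<And>h. proportional (writhe_weight h) n c T T'"
  shows "Q_equivalent n T T'"
  unfolding Q_equivalent_def
  by (rule exI[of _ 1], rule exI[of _ c], rule exI[of _ 0]) (simp add: assms)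

lemma zeta_nonzero: "zeta \<noteq> 0"
  by (simp add: zeta_def inv_sqrt2_def complex_eq_iff)

lemma Q_inv_replace:
  assumes eq: "Q_equivalent n T T'"
    and A: "tangle 0 A (l + n + r)"
    and d: "diagram (A @ embed l r T @ B)" "diagram (A @ embed l r T' @ B)"
  shows "Q_inv (A @ embed l r T' @ B) = Q_inv (A @ embed l r T @ B)"
proof -
  obtain a c k where a: "proportional Q_weight n a T T'" and k: "zeta powi k * a = 1"
    and c: "\<And>h. proportional (writhe_weight h) n (c * exp (h * of_int k)) T T'"
    using eq unfolding Q_equivalent_def by blast
  let ?D = "A @ embed l r T @ B" and ?D' = "A @ embed l r T' @ B"
  have t: "t_plus ?D' = t_plus ?D + k"
    by (rule t_plus_shift[OF d partition_function_replace[OF c A d]])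
  have Z: "partition_function Q_weight ?D' = a * partition_function Q_weight ?D"
    by (rule partition_function_replace[OF a A d])
  have "Q_inv ?D' = zeta powi (t_plus ?D + k) * (a * partition_function Q_weight ?D)"
    by (simp only: Q_inv_eq[OF d(2)] t Z)
  also have "\<dots> = (zeta powi k * a) * (zeta powi t_plus ?D * partition_function Q_weight ?D)"
    by (simp add: power_int_add zeta_nonzero)
  also have "\<dots> = Q_inv ?D"
    by (simp only: k Q_inv_eq[OF d(1)] mult_1_left)
  finally show ?thesis .
qed

lemma Q_inv_replace_rule:
  assumes "replace rule D D'"
    and "\<And>n T T'. rule n T T' \<Longrightarrow> Q_equivalent n T T' \<or> Q_equivalent n T' T"
  shows "Q_inv D' = Q_inv D"
  using assms(1)
proof cases
  case (1 n T T' A l r B)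
  then show ?thesis
    using assms(2)[OF 1(3)] Q_inv_replace[OF _ 1(4)] by metis
qed

section \<open>Verification of the moves\<close>

lemma all_lists_small:
  "(\<forall>u. length u = 1 \<longrightarrow> P u) \<longleftrightarrow> (\<forall>a. P [a])"
  "(\<forall>u. length u = 2 \<longrightarrow> P u) \<longleftrightarrow> (\<forall>a b. P [a, b])"
  "(\<forall>u. length u = 3 \<longrightarrow> P u) \<longleftrightarrow> (\<forall>a b c. P [a, b, c])"
  "(\<forall>u. length u = 4 \<longrightarrow> P u) \<longleftrightarrow> (\<forall>a b c d. P [a, b, c, d])"
  unfolding length_eq_small by auto

text \<open>Again only the terms of nonzero weight are kept; equal labels at the two lower arms of a
  crossing force equal labels at the upper ones, and different labels force different ones.\<close>

lemma transfer_state: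
  "transfer (state_weight x y z w) ((l, Cup, r) # T) f u =
     transfer (state_weight x y z w) T f (take l u @ [False, False] @ drop l u) +
     transfer (state_weight x y z w) T f (take l u @ [True, True] @ drop l u)"
  "l + 2 \<le> length u \<Longrightarrow> transfer (state_weight x y z w) ((l, Cap, r) # T) f u =
     (if u ! l = u ! Suc l then transfer (state_weight x y z w) T f (take l u @ drop (l + 2) u) else 0)"
  "l + 2 \<le> length u \<Longrightarrow> transfer (state_weight x y z w) ((l, Vertex m, r) # T) f u =
     (if u ! l = u ! Suc l then transfer (state_weight x y z w) T f u else 0)"
  "l + 2 \<le> length u \<Longrightarrow> transfer (state_weight x y z w) ((l, Crossing s, r) # T) f u =
     (if u ! l = u ! Suc l
      then x * transfer (state_weight x y z w) T f u +
        (if s = SW_NE then z else w) * transfer (state_weight x y z w) T f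
           (take l u @ [\<not> u ! l, \<not> u ! l] @ drop (l + 2) u)
      else y * transfer (state_weight x y z w) T f
           (take l u @ [u ! Suc l, u ! l] @ drop (l + 2) u) +
        (if s = SW_NE then w else z) * transfer (state_weight x y z w) T f u)"
proof -
  have [simp]: "P (take l u @ a # b # drop (Suc (Suc l)) u) = P u"
    if "l + 2 \<le> length u" "a = u ! l" "b = u ! Suc l" for a b and P :: "bool list \<Rightarrow> 'a"
    using that by (simp add: Cons_nth_drop_Suc)
  have [simp]: "take 2 (drop l u) = [u ! l, u ! Suc l]" if "l + 2 \<le> length u"
    using that by (simp add: numeral_2_eq_2 Cons_nth_drop_Suc[symmetric] take_Suc)
  show "transfer (state_weight x y z w) ((l, Cup, r) # T) f u =
     transfer (state_weight x y z w) T f (take l u @ [False, False] @ drop l u) +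
     transfer (state_weight x y z w) T f (take l u @ [True, True] @ drop l u)"
    by (simp add: transfer.simps(2) sum_labels state_weight_def)
  assume l: "l + 2 \<le> length u"
  show "transfer (state_weight x y z w) ((l, Cap, r) # T) f u =
     (if u ! l = u ! Suc l then transfer (state_weight x y z w) T f (take l u @ drop (l + 2) u) else 0)"
    using l by (simp add: transfer.simps(2) sum_labels state_weight_def)
  show "transfer (state_weight x y z w) ((l, Vertex m, r) # T) f u =
     (if u ! l = u ! Suc l then transfer (state_weight x y z w) T f u else 0)"
    using l by (cases "u ! l"; cases "u ! Suc l") (simp_all add: transfer.simps(2) sum_labels state_weight_def)
  show "transfer (state_weight x y z w) ((l, Crossing s, r) # T) f u =
     (if u ! l = u ! Suc l
      then x * transfer (state_weight x y z w) T f u +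
        (if s = SW_NE then z else w) * transfer (state_weight x y z w) T f
           (take l u @ [\<not> u ! l, \<not> u ! l] @ drop (l + 2) u)
      else y * transfer (state_weight x y z w) T f
           (take l u @ [u ! Suc l, u ! l] @ drop (l + 2) u) +
        (if s = SW_NE then w else z) * transfer (state_weight x y z w) T f u)"
    using l by (cases s; cases "u ! l"; cases "u ! Suc l")
      (simp_all add: transfer.simps(2) sum_labels state_weight_def corner_weight_def add.commute)
qed

lemma inv_sqrt2_square: "inv_sqrt2 * inv_sqrt2 = 1 / 2" "inv_sqrt2 * (inv_sqrt2 * x) = x / 2"
proof -
  show "inv_sqrt2 * inv_sqrt2 = 1 / 2"
    unfolding inv_sqrt2_def by (simp add: of_real_mult[symmetric] del: of_real_mult)
  then show "inv_sqrt2 * (inv_sqrt2 * x) = x / 2"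
    by (simp add: mult.assoc[symmetric])
qed

lemma i_squared_left: "\<i> * (\<i> * x) = - x"
  by (simp add: mult.assoc[symmetric])

lemma exp_cancel_left: "exp h * (exp (- h) * x) = x" "exp (- h) * (exp h * x) = x"
  for h x :: real
  by (simp_all add: mult.assoc[symmetric] mult_exp_exp)

lemmas local_unfold = proportional_def all_lists_small all_bool_eq Q_weight_def
lemmas Q_simps = algebra_simps inv_sqrt2_square i_squared_left

text \<open>If the boundary arc has label \<open>a\<close>, the loop of the kink may have label \<open>a\<close>, with weight \<open>x\<close>, or
  the other label, with weight \<open>w\<close>.\<close>

lemma kink_state:
  "proportional Q_weight 1 ((1 - \<i>) * inv_sqrt2) [] [(1, Cup, 0), (0, Crossing SW_NE, 1), (1, Cap, 0)]"
  unfolding local_unfold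
  by (intro allI conjI; simp add: transfer_state; simp add: Q_simps)

lemma kink_writhe:
  "proportional (writhe_weight h) 1 (exp h) [] [(1, Cup, 0), (0, Crossing SW_NE, 1), (1, Cap, 0)]"
  unfolding local_unfold
  by (intro allI conjI; simp add: transfer_writhe)

lemmas move_unfold = move_sides.simps prod.case local_unfold

lemma state_moves:
  assumes "m \<notin> {Omega1, Omega4, Omega4'}"
  shows "case move_sides m of (n, T, T') \<Rightarrow> proportional Q_weight n 1 T' T"
proof (cases m)
  case Omega2
  show ?thesis unfolding Omega2 move_unfold
    by (intro allI conjI; simp add: transfer_state; simp add: Q_simps)
next
  case Omega3
  show ?thesis unfolding Omega3 move_unfold
    by (intro allI conjI; simp add: transfer_state; simp add: Q_simps)
next
  case Omega5
  show ?thesis unfolding Omega5 move_unfold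
    by (intro allI conjI; simp add: transfer_state; simp add: Q_simps)
next
  case Omega6
  show ?thesis unfolding Omega6 move_unfold
    by (intro allI conjI; simp add: transfer_state; simp add: Q_simps)
next
  case Omega6'
  show ?thesis unfolding Omega6' move_unfold
    by (intro allI conjI; simp add: transfer_state; simp add: Q_simps)
next
  case Omega7
  show ?thesis unfolding Omega7 move_unfold
    by (intro allI conjI; simp add: transfer_state; simp add: Q_simps)
next
  case Omega8
  show ?thesis unfolding Omega8 move_unfold
    by (intro allI conjI; simp add: transfer_state; simp add: Q_simps)
qed (use assms in simp_all)

lemma writhe_moves:
  assumes "m \<notin> {Omega1, Omega4, Omega4'}"
  shows "case move_sides m of (n, T, T') \<Rightarrow>
    proportional (writhe_weight h) n (if m = Omega6 then 2 else 1) T' T"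
proof (cases m)
  case Omega2
  show ?thesis unfolding Omega2 move_unfold
    by (intro allI conjI; simp add: transfer_writhe exp_cancel_left)
next
  case Omega3
  show ?thesis unfolding Omega3 move_unfold
    by (intro allI conjI; simp add: transfer_writhe exp_cancel_left)
next
  case Omega5
  show ?thesis unfolding Omega5 move_unfold
    by (intro allI conjI; simp add: transfer_writhe exp_cancel_left)
next
  case Omega6
  show ?thesis unfolding Omega6 move_unfold
    by (intro allI conjI; simp add: transfer_writhe exp_cancel_left)
next
  case Omega6'
  show ?thesis unfolding Omega6' move_unfold
    by (intro allI conjI; simp add: transfer_writhe exp_cancel_left)
next
  case Omega7
  show ?thesis unfolding Omega7 move_unfold
    by (intro allI conjI; simp add: transfer_writhe exp_cancel_left)
next
  case Omega8
  show ?thesis unfolding Omega8 move_unfold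
    by (intro allI conjI; simp add: transfer_writhe exp_cancel_left)
qed (use assms in simp_all)

lemma Q_equivalent_isotopy:
  assumes "isotopy_rule n T T'"
  shows "Q_equivalent n T T'"
proof (rule Q_equivalentI[where c = 1])
  show "proportional Q_weight n 1 T T'"
    using assms
  proof cases
    case (exchange e d f)
    then show ?thesis by (simp only: proportional_exchange)
  next
    case zigzag_left
    show ?thesis unfolding zigzag_left local_unfold
      by (intro allI conjI; simp add: transfer_state)
  next
    case zigzag_right
    show ?thesis unfolding zigzag_right local_unfold
      by (intro allI conjI; simp add: transfer_state)
  next
    case (rotate_crossing s)
    show ?thesis unfolding rotate_crossing local_unfold
      by (cases s; intro allI conjI; simp add: transfer_state)
  next
    case (rotate_vertex m)
    show ?thesis unfolding rotate_vertex local_unfold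
      by (cases m; intro allI conjI; simp add: transfer_state)
  qed
  show "proportional (writhe_weight h) n 1 T T'" for h
    using assms
  proof cases
    case (exchange e d f)
    then show ?thesis by (simp only: proportional_exchange)
  next
    case zigzag_left
    show ?thesis unfolding zigzag_left local_unfold
      by (intro allI conjI; simp add: transfer_writhe)
  next
    case zigzag_right
    show ?thesis unfolding zigzag_right local_unfold
      by (intro allI conjI; simp add: transfer_writhe)
  next
    case (rotate_crossing s)
    show ?thesis unfolding rotate_crossing local_unfold
      by (cases s; intro allI conjI; simp add: transfer_writhe)
  next
    case (rotate_vertex m)
    show ?thesis unfolding rotate_vertex local_unfold
      by (cases m; intro allI conjI; simp add: transfer_writhe)
  qed
qed

lemma Q_equivalent_move:
  assumes "move_sides m = (n, T, T')" "m \<notin> {Omega4, Omega4'}"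
  shows "Q_equivalent n T' T"
proof (cases "m = Omega1")
  case True
  have "zeta powi 1 * ((1 - \<i>) * inv_sqrt2) = 1"
    by (simp add: zeta_def Q_simps)
  moreover have "\<forall>h. proportional (writhe_weight h) 1 (1 * exp (h * of_int 1)) []
      [(1, Cup, 0), (0, Crossing SW_NE, 1), (1, Cap, 0)]"
    using kink_writhe by simp
  ultimately have "Q_equivalent 1 [] [(1, Cup, 0), (0, Crossing SW_NE, 1), (1, Cap, 0)]"
    using kink_state unfolding Q_equivalent_def by blast
  then show ?thesis
    using assms(1) True by auto
next
  case False
  then show ?thesis
    using assms state_moves[of m] writhe_moves[of m] by (intro Q_equivalentI) auto
qed

section \<open>Invariance\<close>

lemma Q_inv_isotopic:
  assumes "isotopic D D'"
  shows "Q_inv D' = Q_inv D"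
proof -
  have step: "Q_inv E' = Q_inv E" if "replace isotopy_rule E E'" for E E'
    using that Q_equivalent_isotopy by (blast intro: Q_inv_replace_rule)
  show ?thesis
    using assms unfolding isotopic_def
    by (induction rule: equivclp_induct) (use step in \<open>auto dest: step\<close>)
qed

theorem theorem6p1:
  fixes m :: yoshikawa_move and D D' :: "slice list"
  assumes "diagram D" and "diagram D'"
    and "m \<notin> {Omega4, Omega4'}"
    and "obtained_by m D D'"
  shows "Q_inv D' = Q_inv D"
proof -
  obtain E E' where E: "isotopic D E" and move: "replace (move_rule m) E E'" and E': "isotopic E' D'"
    using assms(4) unfolding obtained_by_def by blast
  have "Q_inv E' = Q_inv E"
    using move
  proof (rule Q_inv_replace_rule)
    fix n T T' assume "move_rule m n T T'"
    then show "Q_equivalent n T T' \<or> Q_equivalent n T' T"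
      unfolding move_rule_def using Q_equivalent_move assms(3) by blast
  qed
  then show ?thesis
    using Q_inv_isotopic[OF E] Q_inv_isotopic[OF E'] by simp
qed

end
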